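(* Fix an integer $k\ge 2$. For each $n$, let $\mathcal{A}$ be chosen uniformly at random among the strongly connected elements of $\mathcal{G}_{n,k}$ (the almost-group automata with state set $\{0,\ldots,n-1\}$ over the $k$-letter alphabet $\{a_0,\ldots,a_{k-1}\}$ whose almost-permutation letter is $a_0$). Then, as $n\to\infty$, the probability that $\mathcal{A}$ is not synchronizing is equal to $$(2^{k-1}-1)\,n^{-2(k-1)}\,(1+o(1)).$$ In particular, the probability that a random strongly connected almost-group automaton is synchronizing tends to $1$ as $n$ tends to infinity.
   Context: An automaton (DFA) over a finite alphabet $\Sigma$ is a pair $(Q,\cdot)$ with $Q$ a non-empty finite set of states and $\cdot: Q\times\Sigma\to Q$ a mapping, extended to words by $q\cdot\varepsilon=q$, $q\cdot ua=(q\cdot u)\cdot a$ (no initial or final states). The action of a letter $a$ is the mapping $q\mapsto q\cdot a$. The automaton is strongly connected if for all states $p,q$ there is a word $u$ with $p\cdot u=q$. It is synchronizing if there is a word $u$ with $q\cdot u=q'\cdot u$ for all states $q,q'$. Let $E_n=\{0,\ldots,n-1\}$. A cyclic point of a mapping $f:E_n\to E_n$ is an $x$ with $f^{\ell}(x)=x$ for some $\ell\ge1$. An almost-permutation of $E_n$ is a mapping $E_n\to E_n$ with exactly $n-1$ cyclic points. $\mathcal{G}_{n,k}$ is the set of all automata with state set $E_n$ on the alphabet $\Sigma=\{a_0,\ldots,a_{k-1}\}$ such that $a_0$ acts as an almost-permutation and every other letter acts as a permutation (states are labelled; automata are not counted up to isomorphism). *)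

theory Defs
  imports "HOL-Probability.Probability" "HOL-Library.Landau_Symbols"
begin

unbundle asymp_equiv_syntax

text \<open>
  Transition maps are extensional functions on \<open>Q \<times> \<Sigma>\<close>, so that distinct members of
  \<open>automata Q \<Sigma>\<close> are distinct mappings \<open>Q \<times> \<Sigma> \<rightarrow> Q\<close>, and counting them is meaningful.
\<close>

definition automata :: "'q set \<Rightarrow> 'a set \<Rightarrow> ('q \<times> 'a \<Rightarrow> 'q) set" where
  "automata Q \<Sigma> = {\<delta>. finite Q \<and> Q \<noteq> {} \<and> finite \<Sigma> \<and> \<delta> \<in> Q \<times> \<Sigma> \<rightarrow>\<^sub>E Q}"

definition run :: "('q \<times> 'a \<Rightarrow> 'q) \<Rightarrow> 'q \<Rightarrow> 'a list \<Rightarrow> 'q" where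
  "run \<delta> q u = foldl (\<lambda>p a. \<delta> (p, a)) q u"

definition strongly_connected :: "'q set \<Rightarrow> 'a set \<Rightarrow> ('q \<times> 'a \<Rightarrow> 'q) \<Rightarrow> bool" where
  "strongly_connected Q \<Sigma> \<delta> \<longleftrightarrow> (\<forall>p\<in>Q. \<forall>q\<in>Q. \<exists>u\<in>lists \<Sigma>. run \<delta> p u = q)"

definition synchronizing :: "'q set \<Rightarrow> 'a set \<Rightarrow> ('q \<times> 'a \<Rightarrow> 'q) \<Rightarrow> bool" where
  "synchronizing Q \<Sigma> \<delta> \<longleftrightarrow> (\<exists>u\<in>lists \<Sigma>. \<forall>q\<in>Q. \<forall>q'\<in>Q. run \<delta> q u = run \<delta> q' u)"

definition cyclic_point :: "('q \<Rightarrow> 'q) \<Rightarrow> 'q \<Rightarrow> bool" where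
  "cyclic_point f x \<longleftrightarrow> (\<exists>l\<ge>1. (f ^^ l) x = x)"

text \<open>
  The number of cyclic points is compared through \<open>Suc\<close> to avoid truncated subtraction
  at \<open>n = 0\<close>.
\<close>

definition almost_permutation :: "nat \<Rightarrow> (nat \<Rightarrow> nat) \<Rightarrow> bool" where
  "almost_permutation n f \<longleftrightarrow>
     f \<in> {..<n} \<rightarrow> {..<n} \<and> Suc (card {x \<in> {..<n}. cyclic_point f x}) = n"

text \<open>The letter \<open>a\<^sub>i\<close> is represented by the index \<open>i\<close>.\<close>

definition almost_group_automata :: "nat \<Rightarrow> nat \<Rightarrow> (nat \<times> nat \<Rightarrow> nat) set" where
  "almost_group_automata n k =
     {\<delta> \<in> automata {..<n} {..<k}.
        almost_permutation n (\<lambda>q. \<delta> (q, 0)) \<and>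
        (\<forall>a\<in>{1..<k}. bij_betw (\<lambda>q. \<delta> (q, a)) {..<n} {..<n})}"

definition sc_almost_group_automata :: "nat \<Rightarrow> nat \<Rightarrow> (nat \<times> nat \<Rightarrow> nat) set" where
  "sc_almost_group_automata n k =
     {\<delta> \<in> almost_group_automata n k. strongly_connected {..<n} {..<k} \<delta>}"

text \<open>
  The next two facts ensure that \<open>pmf_of_set (sc_almost_group_automata n k)\<close> is the uniform
  distribution whenever \<open>k \<ge> 2\<close> and \<open>n \<ge> 2\<close>.
\<close>

lemma finite_sc_almost_group_automata: "finite (sc_almost_group_automata n k)"
proof (rule finite_subset)
  show "sc_almost_group_automata n k \<subseteq> {..<n} \<times> {..<k} \<rightarrow>\<^sub>E {..<n}"
    by (auto simp: sc_almost_group_automata_def almost_group_automata_def automata_def)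
qed (auto intro: finite_PiE)

lemma sc_almost_group_automata_nonempty:
  assumes n: "2 \<le> n" and k: "2 \<le> k"
  shows "sc_almost_group_automata n k \<noteq> {}"
proof -
  define g where "g = (\<lambda>q (a::nat). if a = 0 then (if q = 1 then 0 else q) else (q + 1) mod n :: nat)"
  define \<delta> :: "nat \<times> nat \<Rightarrow> nat" where "\<delta> = restrict (\<lambda>(q, a). g q a) ({..<n} \<times> {..<k})"
  have d: "\<delta> (q, a) = g q a" if "q < n" "a < k" for q a
    using that by (simp add: \<delta>_def)
  have "\<delta> \<in> automata {..<n} {..<k}"
    using n by (auto simp: automata_def \<delta>_def g_def lessThan_empty_iff)
  moreover have "almost_permutation n (\<lambda>q. \<delta> (q, 0))"
  proof -
    have pow: "((\<lambda>q. \<delta> (q, 0)) ^^ Suc l) 1 = 0" for l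
      by (induction l) (use n k in \<open>auto simp: d g_def\<close>)
    have "\<not> cyclic_point (\<lambda>q. \<delta> (q, 0)) 1"
      unfolding cyclic_point_def using pow by (metis One_nat_def Suc_le_D zero_neq_one)
    moreover have "cyclic_point (\<lambda>q. \<delta> (q, 0)) x" if "x < n" "x \<noteq> 1" for x
      unfolding cyclic_point_def using that k by (intro exI[of _ 1]) (auto simp: d g_def)
    ultimately have "{x \<in> {..<n}. cyclic_point (\<lambda>q. \<delta> (q, 0)) x} = {..<n} - {1}"
      by auto
    then show ?thesis
      using n k by (auto simp: almost_permutation_def d g_def)
  qed
  moreover have "bij_betw (\<lambda>q. \<delta> (q, a)) {..<n} {..<n}" if a: "a \<in> {1..<k}" for a
  proof -
    have "inj_on (\<lambda>q. \<delta> (q, a)) {..<n}"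
    proof (rule inj_onI)
      fix x y assume "x \<in> {..<n}" "y \<in> {..<n}" "\<delta> (x, a) = \<delta> (y, a)"
      then show "x = y"
        using a by (auto simp: d g_def mod_Suc split: if_splits)
    qed
    moreover have "(\<lambda>q. \<delta> (q, a)) ` {..<n} \<subseteq> {..<n}"
      using n a by (auto simp: d g_def)
    ultimately show ?thesis
      by (simp add: bij_betw_def endo_inj_surj)
  qed
  moreover have "strongly_connected {..<n} {..<k} \<delta>"
    unfolding strongly_connected_def
  proof (intro ballI)
    fix p q assume pq: "p \<in> {..<n}" "q \<in> {..<n}"
    have rep: "run \<delta> p (replicate m 1) = (p + m) mod n" for m
    proof (induction m)
      case 0
      then show ?case using pq by (simp add: run_def)
    next
      case (Suc m)
      have "run \<delta> p (replicate (Suc m) 1) = \<delta> (run \<delta> p (replicate m 1), 1)"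
        by (simp only: replicate_Suc replicate_append_same[symmetric] run_def) simp
      also have "\<dots> = (p + Suc m) mod n"
        using Suc n k by (simp add: d g_def mod_Suc_eq)
      finally show ?case .
    qed
    have "run \<delta> p (replicate (n - p + q) 1) = q"
      using pq by (simp only: rep) simp
    moreover have "replicate (n - p + q) 1 \<in> lists {..<k}"
      using k by auto
    ultimately show "\<exists>u\<in>lists {..<k}. run \<delta> p u = q"
      by blast
  qed
  ultimately have "\<delta> \<in> sc_almost_group_automata n k"
    by (simp add: sc_almost_group_automata_def almost_group_automata_def)
  then show ?thesis by blast
qed

end

theory Submission
  imports Defs "HOL-Combinatorics.Cycles" "HOL-Real_Asymp.Real_Asymp"
begin

text \<open>
  Let \<open>r0\<close> be the non-cyclic point of the letter \<open>0\<close> and \<open>r1\<close> the state with the same image. In a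
  strongly connected automaton \<open>r0\<close> and \<open>r1\<close> are identified by a congruence that is not universal
  unless the automaton is synchronizing, and all classes of this congruence have size \<open>s\<close> or \<open>s - 1\<close>
  where \<open>s\<close> is the size of the class of \<open>r0\<close>. A union bound over the congruences, grouped by their
  type, shows that up to a negligible proportion the class \<open>{r0, r1}\<close> is the only nontrivial one. It
  is then invariant under the \<open>k - 1\<close> permutation letters, which has probability
  \<open>(2 / (n (n - 1)))^(k - 1)\<close>, and strong connectivity excludes that all of them fix \<open>r0\<close>, which
  accounts for the \<open>-1\<close>. Conversely, such an invariant pair prevents synchronization, and a union
  bound over invariant sets shows that strong connectivity is a condition of asymptotic probability 1,
  also among these automata.
\<close>

section \<open>Permutations preserving an equivalence relation\<close>

text \<open>There are far too many congruences to bound them one at a time. The union bound works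
  because one letter pays for the enumeration: over all relations on a finite set with the same
  class sizes, the orders of the stabilizers add up to at most the order of the symmetric group.
  Here \<open>\<sigma>\<close> pays, through the restriction of the congruence to the states other
  than \<open>r0\<close>. A whole type then costs no more than a single relation does in the
  \<open>k - 1\<close> permutation letters. A type is a pair \<open>(s, p)\<close>, where
  \<open>p\<close> counts the states in classes of size \<open>s\<close>, so there are at most
  \<open>(n + 1)^2\<close> types. Scaling by \<open>n^2\<close> per permutation letter and summing
  over the types costs \<open>n^4\<close> when \<open>k = 2\<close>, hence a permutation letter must
  stabilize a relation with probability of order \<open>n^(-5)\<close>. This exponent dictates the
  constants: a class of size at least 7 gives \<open>n * 6! (n - 6)! / n!\<close>, and five classes
  of equal size give at most a constant times \<open>n^5 (n - 10)! / n!\<close>. The types with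
  \<open>s = 2\<close> and \<open>3 \<le> p < 10\<close> reach only \<open>n^(-3)\<close>, which is
  enough because there are seven of them. Invariant sets are handled by the same cancellation: one
  side of the count absorbs the binomial number of sets of each size.\<close>

definition class_profile :: "'a set \<Rightarrow> 'a rel \<Rightarrow> nat \<Rightarrow> nat" where
  "class_profile X R j = card {x \<in> X. card (R `` {x}) = j}"

definition rel_stab :: "'a set \<Rightarrow> 'a rel \<Rightarrow> ('a \<Rightarrow> 'a) set" where
  "rel_stab X R = {\<tau>. \<tau> permutes X \<and> (\<forall>(x, y) \<in> R. (\<tau> x, \<tau> y) \<in> R)}"

lemma finite_rel_stab: "finite X \<Longrightarrow> finite (rel_stab X R)"
  by (rule finite_subset[OF _ finite_permutations[of X]]) (auto simp: rel_stab_def)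

lemma equiv_Int_Times:
  assumes "equiv X R" "X' \<subseteq> X"
  shows "equiv X' (R \<inter> X' \<times> X')"
proof -
  have "refl_on X R" "sym R" "trans R" using assms(1) by (auto simp: equiv_def)
  then show ?thesis
    using assms(2) by (intro equivI) (auto simp: refl_on_def intro!: symI transI dest: symD transD)
qed

text \<open>Classes can be matched one at a time. A class of \<open>R\<close> and a class of
  \<open>S\<close> of the same size are removed, the profiles of the remainders still agree, and the
  bijection given by induction is glued to one between the two classes.\<close>

lemma rel_iso_exists:
  assumes "finite X" "finite Y" "equiv X R" "equiv Y S"
    and "class_profile X R = class_profile Y S"
  shows "\<exists>f. bij_betw f X Y \<and> (\<forall>x\<in>X. \<forall>y\<in>X. (x, y) \<in> R \<longleftrightarrow> (f x, f y) \<in> S)"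
  using assms
proof (induction "card X" arbitrary: X Y R S rule: less_induct)
  case less
  note fin = less.prems(1,2) and R = less.prems(3) and S = less.prems(4) and prof = less.prems(5)
  have RX: "R \<subseteq> X \<times> X" and SY: "S \<subseteq> Y \<times> Y"
    using R S by (auto simp: equiv_def)
  show ?case
  proof (cases "X = {}")
    case True
    have "Y = {}"
    proof (rule ccontr)
      assume "Y \<noteq> {}"
      then obtain y where y: "y \<in> Y" by blast
      have "class_profile Y S (card (S `` {y})) \<noteq> 0"
        using y fin by (auto simp: class_profile_def)
      moreover have "class_profile X R (card (S `` {y})) = 0"
        using True by (simp add: class_profile_def)
      ultimately show False using prof by simp
    qed
    then show ?thesis using True by (auto simp: bij_betw_def)
  next
    case False
    then obtain x where x: "x \<in> X" by blast
    have "class_profile X R (card (R `` {x})) \<noteq> 0"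
      using x fin by (auto simp: class_profile_def)
    then have "class_profile Y S (card (R `` {x})) \<noteq> 0" using prof by simp
    then obtain y where y: "y \<in> Y" "card (S `` {y}) = card (R `` {x})"
      unfolding class_profile_def by (metis (mono_tags, lifting) card_eq_0_iff empty_Collect_eq)
    define C D where "C = R `` {x}" and "D = S `` {y}"
    have sub: "C \<subseteq> X" "D \<subseteq> Y" using RX SY by (auto simp: C_def D_def)
    have finCD: "finite C" "finite D" using sub fin finite_subset by auto
    have xC: "x \<in> C" unfolding C_def by (rule equiv_class_self[OF R x])
    obtain g where g: "bij_betw g C D"
      using finite_same_card_bij[OF finCD] y(2) by (auto simp: C_def D_def)
    define X' Y' where "X' = X - C" and "Y' = Y - D"
    define R' S' where "R' = R \<inter> X' \<times> X'" and "S' = S \<inter> Y' \<times> Y'"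
    have clR: "R `` {z} = C" if "z \<in> C" for z
      using that unfolding C_def by (intro equiv_class_eq[OF R, symmetric]) simp
    have clS: "S `` {z} = D" if "z \<in> D" for z
      using that unfolding D_def by (intro equiv_class_eq[OF S, symmetric]) simp
    have clR': "R' `` {z} = R `` {z}" if "z \<in> X'" for z
    proof -
      have "R `` {z} \<inter> C = {}"
      proof (rule ccontr)
        assume "R `` {z} \<inter> C \<noteq> {}"
        then obtain w where "(z, w) \<in> R" "w \<in> C" by auto
        then have "z \<in> C" using R clR[of w] by (auto simp: equiv_def dest: symD)
        then show False using that by (simp add: X'_def)
      qed
      then show ?thesis using that RX by (auto simp: R'_def X'_def)
    qed
    have clS': "S' `` {z} = S `` {z}" if "z \<in> Y'" for z
    proof -
      have "S `` {z} \<inter> D = {}"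
      proof (rule ccontr)
        assume "S `` {z} \<inter> D \<noteq> {}"
        then obtain w where "(z, w) \<in> S" "w \<in> D" by auto
        then have "z \<in> D" using S clS[of w] by (auto simp: equiv_def dest: symD)
        then show False using that by (simp add: Y'_def)
      qed
      then show ?thesis using that SY by (auto simp: S'_def Y'_def)
    qed
    \<comment> \<open>The profile counts points rather than classes, so removing \<open>C\<close>
      subtracts \<open>card C\<close> at the index \<open>card C\<close> and changes nothing
      else.\<close>
    have p1: "class_profile X R j = class_profile X' R' j + (if j = card C then card C else 0)" for j
    proof -
      have "{z \<in> X. card (R `` {z}) = j} = {z \<in> X'. card (R' `` {z}) = j} \<union> {z \<in> C. card (R `` {z}) = j}"
        using sub clR' by (auto simp: X'_def)
      moreover have "{z \<in> C. card (R `` {z}) = j} = (if j = card C then C else {})"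
        using clR by auto
      moreover have "{z \<in> X'. card (R' `` {z}) = j} \<inter> (if j = card C then C else {}) = {}"
        by (auto simp: X'_def)
      ultimately show ?thesis
        using fin finCD by (simp add: class_profile_def card_Un_disjoint X'_def)
    qed
    have p2: "class_profile Y S j = class_profile Y' S' j + (if j = card D then card D else 0)" for j
    proof -
      have "{z \<in> Y. card (S `` {z}) = j} = {z \<in> Y'. card (S' `` {z}) = j} \<union> {z \<in> D. card (S `` {z}) = j}"
        using sub clS' by (auto simp: Y'_def)
      moreover have "{z \<in> D. card (S `` {z}) = j} = (if j = card D then D else {})"
        using clS by auto
      moreover have "{z \<in> Y'. card (S' `` {z}) = j} \<inter> (if j = card D then D else {}) = {}"
        by (auto simp: Y'_def)
      ultimately show ?thesis
        using fin finCD by (simp add: class_profile_def card_Un_disjoint Y'_def)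
    qed
    have CD: "card C = card D" using y by (simp add: C_def D_def)
    have "class_profile X' R' = class_profile Y' S'"
    proof
      fix j
      show "class_profile X' R' j = class_profile Y' S' j"
        using p1[of j] p2[of j] unfolding CD prof by simp
    qed
    moreover have "card X' < card X"
      using sub xC x fin by (intro psubset_card_mono) (auto simp: X'_def)
    moreover have "equiv X' R'" "equiv Y' S'"
      unfolding R'_def S'_def X'_def Y'_def by (rule equiv_Int_Times[OF R] equiv_Int_Times[OF S]; blast)+
    moreover have "finite X'" "finite Y'" using fin by (auto simp: X'_def Y'_def)
    ultimately obtain h where h: "bij_betw h X' Y'"
      "\<And>u v. u \<in> X' \<Longrightarrow> v \<in> X' \<Longrightarrow> (u, v) \<in> R' \<longleftrightarrow> (h u, h v) \<in> S'"
      using less.hyps[of X' Y' R' S'] by blast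
    define f where "f = (\<lambda>z. if z \<in> C then g z else h z)"
    have fC: "bij_betw f C D" using g by (rule bij_betw_cong[THEN iffD1, rotated]) (simp add: f_def)
    have fX: "bij_betw f X' Y'"
      using h(1) by (rule bij_betw_cong[THEN iffD1, rotated]) (simp add: f_def X'_def)
    have "bij_betw f (C \<union> X') (D \<union> Y')"
      using fC fX by (rule bij_betw_combine) (auto simp: Y'_def)
    then have bij: "bij_betw f X Y"
      using sub by (simp add: X'_def Y'_def Un_absorb1)
    have fD: "f z \<in> D" if "z \<in> C" for z using fC that by (auto simp: bij_betw_def)
    have fY: "f z \<in> Y'" if "z \<in> X'" for z using fX that by (auto simp: bij_betw_def)
    have "(u, v) \<in> R \<longleftrightarrow> (f u, f v) \<in> S" if uv: "u \<in> X" "v \<in> X" for u v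
    proof -
      consider "u \<in> C" | "u \<in> X'" using uv by (auto simp: X'_def)
      then show ?thesis
      proof cases
        case 1
        have "(u, v) \<in> R \<longleftrightarrow> v \<in> C" using clR[OF 1] by auto
        also have "\<dots> \<longleftrightarrow> f v \<in> D" using fD fY uv by (auto simp: X'_def Y'_def)
        also have "\<dots> \<longleftrightarrow> (f u, f v) \<in> S" using clS[OF fD[OF 1]] by auto
        finally show ?thesis .
      next
        case 2
        have a: "(u, v) \<in> R \<longleftrightarrow> v \<in> X' \<and> (u, v) \<in> R'"
          using clR'[OF 2] by (auto simp: R'_def)
        have b: "(f u, f v) \<in> S \<longleftrightarrow> f v \<in> Y' \<and> (f u, f v) \<in> S'"
          using clS'[OF fY[OF 2]] by (auto simp: S'_def)
        have c: "f v \<in> Y' \<longleftrightarrow> v \<in> X'" using fD fY uv by (auto simp: X'_def Y'_def)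
        show ?thesis using a b c h(2)[OF 2, of v] 2
          by (auto simp: f_def X'_def)
      qed
    qed
    then show ?thesis using bij by blast
  qed
qed

text \<open>\<open>rel_stab\<close> asks for one direction only. An injective map of the finite set
  \<open>R\<close> into itself is onto, which supplies the converse.\<close>

lemma rel_stab_image:
  assumes "finite X" "R \<subseteq> X \<times> X" "\<tau> \<in> rel_stab X R"
  shows "map_prod \<tau> \<tau> ` R = R"
proof (rule card_subset_eq)
  have \<tau>: "\<tau> permutes X" "\<And>x y. (x, y) \<in> R \<Longrightarrow> (\<tau> x, \<tau> y) \<in> R"
    using assms(3) by (auto simp: rel_stab_def)
  show "finite R" using assms(1,2) finite_subset by blast
  show "map_prod \<tau> \<tau> ` R \<subseteq> R" using \<tau>(2) by auto
  have "inj (map_prod \<tau> \<tau>)" using permutes_inj[OF \<tau>(1)] by (simp add: prod.inj_map)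
  then show "card (map_prod \<tau> \<tau> ` R) = card R" by (meson card_image inj_on_subset subset_UNIV)
qed

lemma rel_stab_iff:
  assumes "finite X" "R \<subseteq> X \<times> X" "\<tau> \<in> rel_stab X R"
  shows "(\<tau> x, \<tau> y) \<in> R \<longleftrightarrow> (x, y) \<in> R"
proof
  assume "(\<tau> x, \<tau> y) \<in> R"
  then have "(\<tau> x, \<tau> y) \<in> map_prod \<tau> \<tau> ` R" using rel_stab_image[OF assms] by simp
  then show "(x, y) \<in> R"
    using permutes_inj[of \<tau> X] assms(3) by (auto simp: rel_stab_def dest: injD)
qed (use assms in \<open>auto simp: rel_stab_def\<close>)

lemma rel_stab_class:
  assumes "finite X" "R \<subseteq> X \<times> X" "\<tau> \<in> rel_stab X R"
  shows "R `` {\<tau> x} = \<tau> ` (R `` {x})"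
proof
  show "R `` {\<tau> x} \<subseteq> \<tau> ` (R `` {x})"
  proof
    fix z assume "z \<in> R `` {\<tau> x}"
    moreover obtain y where "z = \<tau> y"
      using permutes_surj[of \<tau> X] assms(3) by (auto simp: rel_stab_def surj_def)
    ultimately show "z \<in> \<tau> ` (R `` {x})"
      using rel_stab_iff[OF assms] by auto
  qed
  show "\<tau> ` (R `` {x}) \<subseteq> R `` {\<tau> x}" using rel_stab_iff[OF assms] by auto
qed

lemma rel_stab_class_card:
  assumes "finite X" "R \<subseteq> X \<times> X" "\<tau> \<in> rel_stab X R"
  shows "card (R `` {\<tau> x}) = card (R `` {x})"
proof -
  have "inj \<tau>" using assms(3) permutes_inj by (auto simp: rel_stab_def)
  then show ?thesis
    unfolding rel_stab_class[OF assms] by (meson card_image inj_on_subset subset_UNIV)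
qed

text \<open>
  Choosing \<open>\<pi>\<^sub>R\<close> that carries a fixed \<open>R\<^sub>0\<close> to \<open>R\<close>, the map \<open>(R, \<tau>) \<mapsto> \<tau> \<circ> \<pi>\<^sub>R\<close> is injective, as
  \<open>\<tau> \<circ> \<pi>\<^sub>R\<close> carries \<open>R\<^sub>0\<close> to \<open>R\<close> as well.
\<close>

lemma sum_card_rel_stab_le:
  assumes X: "finite X" and RR: "\<And>R. R \<in> \<R> \<Longrightarrow> equiv X R"
    and prof: "\<And>R S. R \<in> \<R> \<Longrightarrow> S \<in> \<R> \<Longrightarrow> class_profile X R = class_profile X S"
  shows "(\<Sum>R\<in>\<R>. card (rel_stab X R)) \<le> fact (card X)"
proof (cases "\<R> = {}")
  case False
  then obtain R0 where R0: "R0 \<in> \<R>" by blast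
  have sub: "R \<subseteq> X \<times> X" if "R \<in> \<R>" for R using RR[OF that] by (simp add: equiv_def)
  have fin: "finite \<R>"
    by (rule finite_subset[of _ "Pow (X \<times> X)"]) (use sub X in auto)
  have "\<exists>\<pi>. \<pi> permutes X \<and> map_prod \<pi> \<pi> ` R0 = R" if R: "R \<in> \<R>" for R
  proof -
    obtain f where f: "bij_betw f X X" "\<And>x y. x \<in> X \<Longrightarrow> y \<in> X \<Longrightarrow> (x, y) \<in> R0 \<longleftrightarrow> (f x, f y) \<in> R"
      using rel_iso_exists[OF X X RR[OF R0] RR[OF R] prof[OF R0 R]] by blast
    define \<pi> where "\<pi> = (\<lambda>x. if x \<in> X then f x else x)"
    have "bij_betw \<pi> X X" using f(1) by (rule bij_betw_cong[THEN iffD1, rotated]) (simp add: \<pi>_def)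
    then have perm: "\<pi> permutes X" by (rule bij_imp_permutes) (simp add: \<pi>_def)
    have "map_prod \<pi> \<pi> ` R0 \<subseteq> R"
      using f(2) sub[OF R0] by (auto simp: \<pi>_def)
    moreover have "R \<subseteq> map_prod \<pi> \<pi> ` R0"
    proof
      fix z assume z: "z \<in> R"
      then obtain u v where uv: "z = (u, v)" "u \<in> X" "v \<in> X" using sub[OF R] by (cases z) auto
      then have "u \<in> f ` X" "v \<in> f ` X" using f(1) by (auto simp: bij_betw_def)
      then obtain u' v' where "u' \<in> X" "v' \<in> X" "u = f u'" "v = f v'" by blast
      then have "(u', v') \<in> R0" "z = map_prod \<pi> \<pi> (u', v')" using uv z f(2) by (auto simp: \<pi>_def)
      then show "z \<in> map_prod \<pi> \<pi> ` R0" by blast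
    qed
    ultimately show ?thesis using perm by blast
  qed
  then obtain \<pi> where \<pi>: "\<And>R. R \<in> \<R> \<Longrightarrow> \<pi> R permutes X"
      "\<And>R. R \<in> \<R> \<Longrightarrow> map_prod (\<pi> R) (\<pi> R) ` R0 = R"
    by metis
  let ?S = "SIGMA R:\<R>. rel_stab X R"
  have img: "map_prod (\<tau> \<circ> \<pi> R) (\<tau> \<circ> \<pi> R) ` R0 = R" if "R \<in> \<R>" "\<tau> \<in> rel_stab X R" for R \<tau>
  proof -
    have "map_prod (\<tau> \<circ> \<pi> R) (\<tau> \<circ> \<pi> R) ` R0 = map_prod \<tau> \<tau> ` (map_prod (\<pi> R) (\<pi> R) ` R0)"
      by (simp add: image_image map_prod_compose[symmetric] prod.map_comp)
    then show ?thesis using \<pi>(2) rel_stab_image[OF X sub] that by simp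
  qed
  have "inj_on (\<lambda>(R, \<tau>). \<tau> \<circ> \<pi> R) ?S"
  proof (rule inj_onI, clarsimp)
    fix R \<tau> R' \<tau>'
    assume a: "R \<in> \<R>" "\<tau> \<in> rel_stab X R" "R' \<in> \<R>" "\<tau>' \<in> rel_stab X R'"
      and eq: "\<tau> \<circ> \<pi> R = \<tau>' \<circ> \<pi> R'"
    then have "R = R'" using img[OF a(1,2)] img[OF a(3,4)] by simp
    moreover have "\<tau> = \<tau>'"
      using eq permutes_surj[OF \<pi>(1)[OF a(1)]] \<open>R = R'\<close> by (metis surj_fun_eq)
    ultimately show "R = R' \<and> \<tau> = \<tau>'" by simp
  qed
  then have "card ?S = card ((\<lambda>(R, \<tau>). \<tau> \<circ> \<pi> R) ` ?S)" by (simp add: card_image)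
  also have "\<dots> \<le> card {p. p permutes X}"
    using X \<pi>(1) by (intro card_mono) (auto simp: finite_permutations rel_stab_def intro: permutes_compose)
  also have "\<dots> = fact (card X)" using X card_permutations by blast
  finally show ?thesis
    using fin X by (simp add: card_SigmaI finite_rel_stab)
qed auto

text \<open>If some \<open>\<rho>\<close> maps \<open>S\<close> onto \<open>S'\<close>, then
  following \<open>\<tau>\<close> by the inverse of \<open>\<rho>\<close> gives a permutation that
  preserves \<open>S\<close> and its complement. It is determined by its two restrictions, which are
  counted by the two factorials.\<close>

lemma card_permutes_image_le:
  assumes X: "finite X" "S \<subseteq> X"
  shows "card {\<tau>. \<tau> permutes X \<and> \<tau> ` S = S'} \<le> fact (card S) * fact (card X - card S)"
proof (cases "\<exists>\<tau>. \<tau> permutes X \<and> \<tau> ` S = S'")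
  case True
  then obtain \<rho> where \<rho>: "\<rho> permutes X" "\<rho> ` S = S'" by blast
  let ?A = "{\<tau>. \<tau> permutes X \<and> \<tau> ` S = S'}"
  let ?\<phi> = "\<lambda>\<tau>. (\<lambda>x. if x \<in> S then inv \<rho> (\<tau> x) else x, \<lambda>x. if x \<in> X - S then inv \<rho> (\<tau> x) else x)"
  have inv: "inv \<rho> permutes X" using \<rho>(1) by (rule permutes_inv)
  have iS: "inv \<rho> ` S' = S" using \<rho> by (metis bij_image_Collect_eq image_inv_f_f permutes_inj)
  have "?\<phi> \<tau> \<in> {p. p permutes S} \<times> {p. p permutes (X - S)}" if "\<tau> \<in> ?A" for \<tau>
  proof -
    have \<tau>: "\<tau> permutes X" "\<tau> ` S = S'" using that by auto
    define \<kappa> where "\<kappa> = inv \<rho> \<circ> \<tau>"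
    have \<kappa>: "\<kappa> permutes X" using permutes_compose[OF \<tau>(1) inv] by (simp add: \<kappa>_def)
    have S: "\<kappa> ` S = S" unfolding \<kappa>_def image_comp[symmetric] \<tau>(2) iS ..
    have XS: "\<kappa> ` (X - S) = X - S"
      using permutes_image[OF \<kappa>] permutes_inj[OF \<kappa>] S by (simp add: image_set_diff)
    have "bij_betw \<kappa> S S" "bij_betw \<kappa> (X - S) (X - S)"
      using S XS permutes_inj[OF \<kappa>] by (auto simp: bij_betw_def intro: inj_on_subset)
    moreover have "(\<lambda>x. if x \<in> A then \<kappa> x else x) permutes A" if "bij_betw \<kappa> A A" for A
    proof (rule bij_imp_permutes)
      show "bij_betw (\<lambda>x. if x \<in> A then \<kappa> x else x) A A"
        using that by (rule bij_betw_cong[THEN iffD1, rotated]) simp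
    qed simp
    ultimately have "(\<lambda>x. if x \<in> S then \<kappa> x else x) permutes S"
         "(\<lambda>x. if x \<in> X - S then \<kappa> x else x) permutes (X - S)"
      by blast+
    then show ?thesis unfolding \<kappa>_def o_def by simp
  qed
  moreover have "inj_on ?\<phi> ?A"
  proof (rule inj_onI)
    fix \<tau> \<tau>' assume t: "\<tau> \<in> ?A" "\<tau>' \<in> ?A" and eq: "?\<phi> \<tau> = ?\<phi> \<tau>'"
    show "\<tau> = \<tau>'"
    proof
      fix x
      show "\<tau> x = \<tau>' x"
      proof (cases "x \<in> X")
        case True
        have "inv \<rho> (\<tau> x) = inv \<rho> (\<tau>' x)"
          using True fun_cong[OF arg_cong[OF eq, of fst], of x] fun_cong[OF arg_cong[OF eq, of snd], of x]
          by (auto split: if_splits)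
        then show ?thesis using permutes_inj[OF inv] by (auto dest: injD)
      next
        case False
        then show ?thesis using t permutes_not_in[of \<tau> X x] permutes_not_in[of \<tau>' X x] by simp
      qed
    qed
  qed
  ultimately have "card ?A \<le> card ({p. p permutes S} \<times> {p. p permutes (X - S)})"
    using X finite_subset[OF X(2,1)]
    by (intro card_inj_on_le[of ?\<phi>] finite_cartesian_product finite_permutations) auto
  also have "\<dots> = fact (card S) * fact (card X - card S)"
    using X finite_subset[OF X(2,1)] by (simp add: card_cartesian_product card_permutations card_Diff_subset)
  finally show ?thesis .
next
  case False
  then have "{\<tau>. \<tau> permutes X \<and> \<tau> ` S = S'} = {}" by blast
  then show ?thesis by (simp only: card.empty)
qed

text \<open>A stabilizing permutation carries classes to classes, so its values on the
  representatives \<open>E\<close> determine the image of the union of their classes. This leaves at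
  most \<open>card X ^ card E\<close> images, each handled by the bound for a prescribed
  image.\<close>

lemma card_rel_stab_le:
  assumes X: "finite X" "R \<subseteq> X \<times> X" and E: "E \<subseteq> X"
  shows "card (rel_stab X R) \<le>
    card X ^ card E * (fact (card (R `` E)) * fact (card X - card (R `` E)))"
proof -
  let ?S = "R `` E"
  let ?F = "(\<lambda>g. \<Union>x\<in>E. R `` {g x}) ` (E \<rightarrow>\<^sub>E X)"
  have fE: "finite E" using X E finite_subset by blast
  have S: "?S \<subseteq> X" using X by auto
  have im: "\<tau> ` ?S \<in> ?F" if \<tau>: "\<tau> \<in> rel_stab X R" for \<tau>
  proof -
    have "\<tau> ` ?S = (\<Union>x\<in>E. R `` {\<tau> x})"
      unfolding rel_stab_class[OF X \<tau>] by auto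
    also have "\<dots> = (\<Union>x\<in>E. R `` {restrict \<tau> E x})" by simp
    also have "\<dots> \<in> ?F"
      using \<tau> E by (intro imageI) (auto simp: rel_stab_def permutes_in_image)
    finally show ?thesis .
  qed
  have fin: "finite (E \<rightarrow>\<^sub>E X)" using fE X by (simp add: finite_PiE)
  have "rel_stab X R \<subseteq> (\<Union>S'\<in>?F. {\<tau>. \<tau> permutes X \<and> \<tau> ` ?S = S'})"
  proof
    fix \<tau> assume "\<tau> \<in> rel_stab X R"
    then show "\<tau> \<in> (\<Union>S'\<in>?F. {\<tau>. \<tau> permutes X \<and> \<tau> ` ?S = S'})"
      by (intro UN_I[of "\<tau> ` ?S"] im) (simp_all add: rel_stab_def)
  qed
  then have "card (rel_stab X R) \<le> card (\<Union>S'\<in>?F. {\<tau>. \<tau> permutes X \<and> \<tau> ` ?S = S'})"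
    using X fin by (intro card_mono) (auto simp: finite_permutations)
  also have "\<dots> \<le> (\<Sum>S'\<in>?F. card {\<tau>. \<tau> permutes X \<and> \<tau> ` ?S = S'})"
    using fin by (intro card_UN_le) auto
  also have "\<dots> \<le> card ?F * (fact (card ?S) * fact (card X - card ?S))"
    using sum_bounded_above[of ?F "\<lambda>S'. card {\<tau>. \<tau> permutes X \<and> \<tau> ` ?S = S'}"
        "fact (card ?S) * fact (card X - card ?S)"] card_permutes_image_le[OF X(1) S] by simp
  also have "card ?F \<le> card (E \<rightarrow>\<^sub>E X)" by (rule card_image_le[OF fin])
  also have "card (E \<rightarrow>\<^sub>E X) = card X ^ card E" using fE by (simp add: card_PiE)
  finally show ?thesis by simp
qed

section \<open>Stable pairs in almost-group automata\<close>

lemma run_Nil [simp]: "run \<delta> q [] = q"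
  and run_Cons [simp]: "run \<delta> q (a # u) = run \<delta> (\<delta> (q, a)) u"
  and run_append [simp]: "run \<delta> q (u @ v) = run \<delta> (run \<delta> q u) v"
  by (simp_all add: run_def)

locale almost_group_automaton =
  fixes n k r0 r1 :: nat and \<sigma> :: "nat \<Rightarrow> nat" and B :: "nat \<Rightarrow> nat \<Rightarrow> nat"
    and \<delta> :: "nat \<times> nat \<Rightarrow> nat"
  assumes k: "2 \<le> k" and r0: "r0 < n" and r1: "r1 < n" and r01: "r0 \<noteq> r1"
    and \<sigma>: "\<sigma> permutes {..<n} - {r0}"
    and B: "\<And>a. a \<in> {1..<k} \<Longrightarrow> B a permutes {..<n}"
    and \<delta>_0: "\<And>q. q < n \<Longrightarrow> \<delta> (q, 0) = \<sigma> (if q = r0 then r1 else q)"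
    and \<delta>_Suc: "\<And>q a. q < n \<Longrightarrow> a \<in> {1..<k} \<Longrightarrow> \<delta> (q, a) = B a q"
begin

lemma \<sigma>_in: "x < n \<Longrightarrow> x \<noteq> r0 \<Longrightarrow> \<sigma> x < n \<and> \<sigma> x \<noteq> r0"
  using permutes_in_image[OF \<sigma>, of x] by auto

lemma \<delta>_0_in: "q < n \<Longrightarrow> \<delta> (q, 0) < n \<and> \<delta> (q, 0) \<noteq> r0"
  using \<sigma>_in r1 r01 by (auto simp: \<delta>_0)

lemma B_in: "a \<in> {1..<k} \<Longrightarrow> B a x < n \<longleftrightarrow> x < n"
  using permutes_in_image[OF B, of a x] by auto

lemma letter_cases [consumes 1, case_names zero perm]:
  assumes "a \<in> {..<k}"
  obtains "a = 0" | "a \<in> {1..<k}"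
  using assms by force

lemma \<delta>_in: "q < n \<Longrightarrow> a \<in> {..<k} \<Longrightarrow> \<delta> (q, a) < n"
  by (erule letter_cases) (auto simp: \<delta>_0_in \<delta>_Suc B_in)

lemma run_in: "u \<in> lists {..<k} \<Longrightarrow> q < n \<Longrightarrow> run \<delta> q u < n"
  by (induction u arbitrary: q) (auto simp: \<delta>_in)

lemma strongly_connectedD:
  "strongly_connected {..<n} {..<k} \<delta> \<Longrightarrow> p < n \<Longrightarrow> q < n \<Longrightarrow> \<exists>w\<in>lists {..<k}. run \<delta> p w = q"
  unfolding strongly_connected_def by blast

lemma run_invariant:
  assumes step: "\<And>q a. q < n \<Longrightarrow> P q \<Longrightarrow> a \<in> {..<k} \<Longrightarrow> P (\<delta> (q, a))"
  shows "u \<in> lists {..<k} \<Longrightarrow> q < n \<Longrightarrow> P q \<Longrightarrow> P (run \<delta> q u)"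
  by (induction u arbitrary: q) (auto simp: \<delta>_in step)

lemma run_replicate_0: "q < n \<Longrightarrow> q \<noteq> r0 \<Longrightarrow> run \<delta> q (replicate l 0) = (\<sigma> ^^ l) q"
  by (induction l arbitrary: q) (auto simp: \<delta>_0 \<sigma>_in funpow_swap1)

lemma \<sigma>_nilpotent: obtains l where "\<sigma> ^^ l = id" "l > 0"
proof -
  have "permutation \<sigma>" using permutes_imp_permutation[OF _ \<sigma>] by simp
  then show ?thesis by (rule permutation_is_nilpotent) (rule that)
qed

end

text \<open>With only the sizes \<open>s - 1\<close> and \<open>s\<close> available,
  \<open>s\<close> and \<open>p\<close> fix the whole class profile. Relations of one type therefore
  satisfy the hypothesis of the summed stabilizer bound.\<close>

definition two_size_rels :: "nat \<Rightarrow> nat \<Rightarrow> nat \<Rightarrow> nat \<Rightarrow> nat \<Rightarrow> nat rel set" where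
  "two_size_rels n r0 r1 s p =
     {R. equiv {..<n} R \<and> R \<noteq> {..<n} \<times> {..<n} \<and> (r0, r1) \<in> R \<and> card (R `` {r0}) = s \<and>
         class_profile {..<n} R s = p \<and> (\<forall>x<n. card (R `` {x}) \<in> {s - 1, s})}"

context almost_group_automaton
begin

text \<open>
  A word \<open>u\<close> of minimal rank yields the congruence \<open>p \<sim> q \<longleftrightarrow> (\<forall>v. p \<cdot> v u = q \<cdot> v u)\<close>. To see that
  \<open>r0 \<sim> r1\<close>, take an image \<open>F \<ni> r0\<close> of minimal size. Then \<open>r1 \<notin> F\<close>, and acting with a power of
  the letter \<open>0\<close> on \<open>F\<close> exchanges \<open>r0\<close> for \<open>r1\<close>, so both \<open>F\<close> and \<open>F - {r0} \<union> {r1}\<close> are mapped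
  bijectively onto the same image of minimal size.
\<close>

lemma nonsync_congruence:
  assumes sc: "strongly_connected {..<n} {..<k} \<delta>" and ns: "\<not> synchronizing {..<n} {..<k} \<delta>"
  obtains R where "equiv {..<n} R" "R \<noteq> {..<n} \<times> {..<n}" "(r0, r1) \<in> R"
    "\<And>p q a. (p, q) \<in> R \<Longrightarrow> a \<in> {..<k} \<Longrightarrow> (\<delta> (p, a), \<delta> (q, a)) \<in> R"
proof -
  define img where "img = (\<lambda>w. (\<lambda>q. run \<delta> q w) ` {..<n})"
  have fin: "finite (img w)" for w by (simp add: img_def)
  have img_app: "img (w @ x) = (\<lambda>q. run \<delta> q x) ` img w" for w x
    by (auto simp: img_def image_image)
  obtain u where u: "u \<in> lists {..<k}" "\<And>w. w \<in> lists {..<k} \<Longrightarrow> card (img u) \<le> card (img w)"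
    using ex_has_least_nat[of "\<lambda>w. w \<in> lists {..<k}" "[]" "\<lambda>w. card (img w)"] by auto
  define m where "m = card (img u)"
  have le: "m \<le> card (img w)" if "w \<in> lists {..<k}" for w using u(2)[OF that] by (simp add: m_def)
  \<comment> \<open>On an image of minimal size every word acts injectively, since otherwise the
    size would drop below \<open>m\<close>.\<close>
  have inj: "inj_on (\<lambda>q. run \<delta> q x) (img w)"
    if "card (img w) = m" "w \<in> lists {..<k}" "x \<in> lists {..<k}" for w x
  proof (rule eq_card_imp_inj_on[OF fin])
    have "m \<le> card (img (w @ x))" using that by (intro le) auto
    then show "card ((\<lambda>q. run \<delta> q x) ` img w) = card (img w)"
      using card_image_le[OF fin, of "\<lambda>q. run \<delta> q x" w] that by (simp add: img_app)
  qed
  define R where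
    "R = {(p, q). p < n \<and> q < n \<and> (\<forall>v\<in>lists {..<k}. run \<delta> p (v @ u) = run \<delta> q (v @ u))}"
  have eq: "equiv {..<n} R"
    by (rule equivI) (auto simp: R_def refl_on_def sym_def trans_def)
  moreover have "R \<noteq> {..<n} \<times> {..<n}"
  proof
    assume full: "R = {..<n} \<times> {..<n}"
    have "run \<delta> q u = run \<delta> q' u" if "q < n" "q' < n" for q q'
    proof -
      have "(q, q') \<in> R" using that full by simp
      then show ?thesis by (auto simp: R_def dest: bspec[of _ _ "[]"])
    qed
    then show False using ns u(1) unfolding synchronizing_def by blast
  qed
  moreover have "(\<delta> (p, a), \<delta> (q, a)) \<in> R" if R: "(p, q) \<in> R" and a: "a \<in> {..<k}" for p q a
  proof -
    have "run \<delta> (\<delta> (p, a)) (v @ u) = run \<delta> (\<delta> (q, a)) (v @ u)" if "v \<in> lists {..<k}" for v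
    proof -
      have "a # v \<in> lists {..<k}" using that a by auto
      then have "run \<delta> p ((a # v) @ u) = run \<delta> q ((a # v) @ u)" using R unfolding R_def by blast
      then show ?thesis by simp
    qed
    then show ?thesis using R a \<delta>_in by (auto simp: R_def)
  qed
  moreover have "(r0, r1) \<in> R"
  proof -
    obtain q where q: "q \<in> img u" using r0 by (auto simp: img_def)
    have "q < n" using q run_in[OF u(1)] by (auto simp: img_def)
    then obtain w where w: "w \<in> lists {..<k}" "run \<delta> q w = r0"
      using strongly_connectedD[OF sc _ r0] by blast
    define F where "F = img (u @ w)"
    have uw: "u @ w \<in> lists {..<k}" using u w by simp
    have rF: "r0 \<in> F" unfolding F_def img_app using q w(2) by auto
    have cF: "card (img (u @ w)) = m"
      using le[OF uw] card_image_le[OF fin[of u], of "\<lambda>q. run \<delta> q w"] by (simp add: img_app m_def)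
    have z: "[0] \<in> lists {..<k}" using k by simp
    have nF: "r1 \<notin> F"
    proof
      assume "r1 \<in> F"
      moreover have "run \<delta> r0 [0] = run \<delta> r1 [0]" using \<delta>_0 r0 r1 by simp
      ultimately show False using inj[OF cF uw z] rF r01 by (auto simp: F_def dest: inj_onD)
    qed
    obtain l where l: "\<sigma> ^^ l = id" "l > 0" by (rule \<sigma>_nilpotent)
    \<comment> \<open>The word \<open>Z\<close> fixes every state except \<open>r0\<close>, because
      \<open>\<sigma> ^^ l\<close> is the identity. It sends \<open>r0\<close> where it sends
      \<open>r1\<close>, because its first letter fuses them.\<close>
    define Z where "Z = replicate l (0::nat)"
    have Z: "Z \<in> lists {..<k}" using k by (auto simp: Z_def)
    have FX: "F \<subseteq> {..<n}" using run_in[OF uw] by (auto simp: F_def img_def)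
    have Zr: "run \<delta> x Z = x" if "x < n" "x \<noteq> r0" for x
      using run_replicate_0[OF that, of l] l by (simp add: Z_def)
    have Zr0: "run \<delta> r0 Z = r1"
    proof -
      have "run \<delta> r0 Z = run \<delta> r1 Z" using l(2) \<delta>_0 r0 r1 by (cases l) (auto simp: Z_def)
      then show ?thesis using Zr[OF r1] r01 by simp
    qed
    have uwZ: "(u @ w) @ Z \<in> lists {..<k}" using uw Z by simp
    have F': "img ((u @ w) @ Z) = insert r1 (F - {r0})"
    proof -
      have "F = insert r0 (F - {r0})" using rF by auto
      then have "img ((u @ w) @ Z) = (\<lambda>q. run \<delta> q Z) ` insert r0 (F - {r0})"
        unfolding img_app[of "u @ w"] F_def[symmetric] by simp
      also have "\<dots> = insert r1 ((\<lambda>q. run \<delta> q Z) ` (F - {r0}))"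
        by (simp only: image_insert Zr0)
      also have "(\<lambda>q. run \<delta> q Z) ` (F - {r0}) = (\<lambda>q. q) ` (F - {r0})"
        using FX Zr by (intro image_cong) auto
      finally show ?thesis by simp
    qed
    have cF': "card (img ((u @ w) @ Z)) = m"
    proof -
      have "card F = Suc (card (F - {r0}))" using rF fin[of "u @ w"] card_Suc_Diff1 by (metis F_def)
      then show ?thesis
        using nF fin[of "u @ w"] cF unfolding F' by (simp add: F_def)
    qed
    have "run \<delta> r0 (v @ u) = run \<delta> r1 (v @ u)" if v: "v \<in> lists {..<k}" for v
    proof -
      define I where "I = (\<lambda>q. run \<delta> q (v @ u))"
      have vu: "v @ u \<in> lists {..<k}" using v u by simp
      \<comment> \<open>The target does not depend on \<open>y\<close>: each image of minimal size
        lands inside \<open>img (v @ u)\<close>, which itself has size \<open>m\<close>.\<close>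
      have full: "I ` img y = img (v @ u)" if y: "card (img y) = m" "y \<in> lists {..<k}" for y
      proof (rule card_subset_eq[OF fin])
        have "y @ v \<in> lists {..<k}" using y v by simp
        then show "I ` img y \<subseteq> img (v @ u)"
          using run_in[OF y(2)] by (auto simp: I_def img_def)
        have "img (v @ u) \<subseteq> img u" using run_in[OF v] by (auto simp: img_def)
        then have "card (img (v @ u)) = m"
          using le[OF vu] card_mono[OF fin[of u], of "img (v @ u)"] by (simp add: m_def)
        then show "card (I ` img y) = card (img (v @ u))"
          using card_image[OF inj[OF y vu]] y by (simp add: I_def)
      qed
      have "I r0 \<in> I ` img ((u @ w) @ Z)"
        using full[OF cF' uwZ] full[OF cF uw] rF by (auto simp: F_def)
      then obtain y where y: "y \<in> insert r1 (F - {r0})" "I r0 = I y" unfolding F' by blast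
      \<comment> \<open>Injectivity of \<open>I\<close> on \<open>F\<close>, which contains
        \<open>r0\<close>, excludes every \<open>y\<close> in \<open>F - {r0}\<close>.\<close>
      then have "y = r1"
        using inj[OF cF uw vu] rF by (auto simp: F_def I_def dest: inj_onD)
      then show ?thesis using y by (simp add: I_def)
    qed
    then show ?thesis using r0 r1 by (simp add: R_def)
  qed
  ultimately show ?thesis using that by blast
qed

lemma nonsync_two_size_rel:
  assumes sc: "strongly_connected {..<n} {..<k} \<delta>" and ns: "\<not> synchronizing {..<n} {..<k} \<delta>"
  shows "\<exists>s p. \<exists>R \<in> two_size_rels n r0 r1 s p. (\<forall>a\<in>{1..<k}. B a \<in> rel_stab {..<n} R) \<and>
     \<sigma> \<in> rel_stab ({..<n} - {r0}) (R \<inter> ({..<n} - {r0}) \<times> ({..<n} - {r0}))"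
proof -
  obtain R where R: "equiv {..<n} R" "R \<noteq> {..<n} \<times> {..<n}" "(r0, r1) \<in> R"
    and cong: "\<And>p q a. (p, q) \<in> R \<Longrightarrow> a \<in> {..<k} \<Longrightarrow> (\<delta> (p, a), \<delta> (q, a)) \<in> R"
    using nonsync_congruence[OF sc ns] by blast
  define R' where "R' = R \<inter> ({..<n} - {r0}) \<times> ({..<n} - {r0})"
  have RX: "R \<subseteq> {..<n} \<times> {..<n}" using R(1) by (simp add: equiv_def)
  have BR: "B a \<in> rel_stab {..<n} R" if a: "a \<in> {1..<k}" for a
  proof -
    have "(B a x, B a y) \<in> R" if "(x, y) \<in> R" for x y
      using cong[OF that, of a] a that RX by (auto simp: \<delta>_Suc)
    then show ?thesis using B[OF a] by (auto simp: rel_stab_def)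
  qed
  have \<sigma>R: "\<sigma> \<in> rel_stab ({..<n} - {r0}) R'"
  proof -
    have "(\<sigma> x, \<sigma> y) \<in> R'" if xy: "(x, y) \<in> R'" for x y
    proof -
      have "(\<sigma> x, \<sigma> y) \<in> R"
        using cong[of x y 0] k xy by (auto simp: \<delta>_0 R'_def)
      then show ?thesis using xy \<sigma>_in by (auto simp: R'_def)
    qed
    then show ?thesis using \<sigma> by (auto simp: rel_stab_def)
  qed
  define c where "c = (\<lambda>x. card (R `` {x}))"
  define s where "s = c r0"
  have fincl: "finite (R `` {x})" for x by (rule finite_subset[of _ "{..<n}"]) (use RX in auto)
  have cl: "c x = s" if "(x, r0) \<in> R" for x
    using equiv_class_eq[OF R(1) that] by (simp add: c_def s_def)
  have r01R: "(r1, r0) \<in> R" using R(1,3) by (auto simp: equiv_def dest: symD)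
  \<comment> \<open>Deleting \<open>r0\<close> shortens the class of \<open>r0\<close> by one and
    leaves all other classes intact.\<close>
  have c': "card (R' `` {x}) = (if (x, r0) \<in> R then s - 1 else c x)" if "x < n" "x \<noteq> r0" for x
  proof -
    have "R' `` {x} = R `` {x} - {r0}" using that RX by (auto simp: R'_def)
    then show ?thesis
      using cl[of x] fincl by (auto simp: c_def card_Diff_singleton)
  qed
  \<comment> \<open>Permutation letters preserve class sizes in \<open>R\<close>, and
    \<open>\<sigma>\<close> preserves them in \<open>R'\<close>. The two sizes differ only on the
    class of \<open>r0\<close>, so the letter \<open>0\<close> can change a size only between
    \<open>s\<close> and \<open>s - 1\<close>, on entering or leaving that class. Strong
    connectivity spreads the conclusion from \<open>r0\<close> to all states.\<close>
  have "c (run \<delta> r0 w) \<in> {s - 1, s}" if w: "w \<in> lists {..<k}" for w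
  proof (rule run_invariant[OF _ w r0])
    fix q a assume q: "q < n" "c q \<in> {s - 1, s}" and a: "a \<in> {..<k}"
    from a show "c (\<delta> (q, a)) \<in> {s - 1, s}"
    proof (cases rule: letter_cases)
      case perm
      then show ?thesis
        using q rel_stab_class_card[OF _ RX BR[OF perm], of q] by (simp add: \<delta>_Suc c_def)
    next
      case zero
      define x where "x = (if q = r0 then r1 else q)"
      have x: "x < n" "x \<noteq> r0" "c x \<in> {s - 1, s}"
        using q r1 r01 cl[OF r01R] by (auto simp: x_def)
      have "card (R' `` {\<sigma> x}) = card (R' `` {x})"
        by (rule rel_stab_class_card[OF _ _ \<sigma>R]) (auto simp: R'_def)
      then have "c (\<sigma> x) \<in> {s - 1, s}"
        using x c'[of x] c'[of "\<sigma> x"] \<sigma>_in[of x] cl[of "\<sigma> x"] by (auto split: if_splits)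
      then show ?thesis using q by (simp add: zero \<delta>_0 x_def)
    qed
  qed (simp add: s_def)
  then have "c x \<in> {s - 1, s}" if "x < n" for x
    using strongly_connectedD[OF sc r0 that] by blast
  then have "R \<in> two_size_rels n r0 r1 s (class_profile {..<n} R s)"
    using R by (auto simp: two_size_rels_def c_def s_def)
  then show ?thesis using BR \<sigma>R unfolding R'_def by blast
qed

section \<open>Invariant pairs and invariant sets as obstructions\<close>

lemma not_synchronizing_if_pair_invariant:
  assumes n: "n \<ge> 3" and inv: "\<And>a. a \<in> {1..<k} \<Longrightarrow> B a ` {r0, r1} = {r0, r1}"
  shows "\<not> synchronizing {..<n} {..<k} \<delta>"
proof
  assume "synchronizing {..<n} {..<k} \<delta>"
  then obtain u where u: "u \<in> lists {..<k}" "\<And>q q'. q < n \<Longrightarrow> q' < n \<Longrightarrow> run \<delta> q u = run \<delta> q' u"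
    by (auto simp: synchronizing_def)
  have "\<exists>y<n. y \<noteq> r0 \<and> y \<noteq> r1"
  proof (rule ccontr)
    assume "\<not> ?thesis"
    then have "{..<n} \<subseteq> {r0, r1}" by auto
    then have "card {..<n} \<le> card {r0, r1}" by (intro card_mono) auto
    then show False using n r01 by simp
  qed
  then obtain y where y: "y < n" "y \<noteq> r0" "y \<noteq> r1" by blast
  \<comment> \<open>Two distinct states other than the pair \<open>r0\<close>, \<open>r1\<close> can
    never become that pair: permutation letters preserve it, and the letter \<open>0\<close> never
    outputs \<open>r0\<close>. As only this pair is fused by a letter, the two states stay distinct.
    The third state \<open>y\<close> supplies such a starting pair.\<close>
  define P where "P = (\<lambda>x y. x \<noteq> y \<and> \<not> (x \<in> {r0, r1} \<and> y \<in> {r0, r1}))"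
  have mem: "B a x \<in> {r0, r1} \<longleftrightarrow> x \<in> {r0, r1}" if "a \<in> {1..<k}" for a x
    using inj_image_mem_iff[OF permutes_inj[OF B[OF that]], of x "{r0, r1}"]
    unfolding inv[OF that] .
  have step: "P (\<delta> (x, a)) (\<delta> (y, a))" if "x < n" "y < n" "P x y" "a \<in> {..<k}" for x y a
    using that(4)
  proof (cases rule: letter_cases)
    case perm
    then show ?thesis
      using that mem[OF perm] permutes_inj[OF B[OF perm]] unfolding P_def
      by (auto simp: \<delta>_Suc dest: injD)
  next
    case zero
    have "\<delta> (x, 0) \<noteq> \<delta> (y, 0)"
      using that permutes_inj[OF \<sigma>] by (auto simp: P_def \<delta>_0 split: if_splits dest: injD)
    then show ?thesis using \<delta>_0_in[of x] \<delta>_0_in[of y] that zero by (auto simp: P_def)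
  qed
  have "w \<in> lists {..<k} \<Longrightarrow> x < n \<Longrightarrow> y < n \<Longrightarrow> P x y \<Longrightarrow> P (run \<delta> x w) (run \<delta> y w)" for x y w
    by (induction w arbitrary: x y) (auto simp: \<delta>_in step)
  from this[OF u(1) r0 y(1)] y have "run \<delta> r0 u \<noteq> run \<delta> y u" by (auto simp: P_def)
  then show False using u(2) r0 y by blast
qed

text \<open>The letter \<open>0\<close> never reaches \<open>r0\<close>. If all permutation letters
  fixed \<open>r0\<close>, no other state could reach it.\<close>

lemma strongly_connected_moves_r0:
  assumes sc: "strongly_connected {..<n} {..<k} \<delta>"
  shows "\<exists>a\<in>{1..<k}. B a r0 \<noteq> r0"
proof (rule ccontr)
  assume "\<not> ?thesis"
  then have fix0: "B a r0 = r0" if "a \<in> {1..<k}" for a using that by blast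
  obtain w where w: "w \<in> lists {..<k}" "run \<delta> r1 w = r0"
    using strongly_connectedD[OF sc r1 r0] by blast
  have "run \<delta> r1 w \<noteq> r0"
  proof (rule run_invariant[OF _ w(1) r1])
    fix q a assume q: "q < n" "q \<noteq> r0" and a: "a \<in> {..<k}"
    from a show "\<delta> (q, a) \<noteq> r0"
    proof (cases rule: letter_cases)
      case zero
      then show ?thesis using \<delta>_0_in q by simp
    next
      case perm
      then show ?thesis
        using q fix0[OF perm] permutes_inj[OF B[OF perm]] by (metis \<delta>_Suc injD)
    qed
  qed (use r01 in auto)
  then show False using w by simp
qed

text \<open>\<open>Y\<close> is the set of states reachable from some \<open>p\<close> that misses a
  state \<open>q\<close>. It is closed under the letters, and a finite set mapped into itself by an
  injection is mapped onto itself.\<close>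

lemma not_strongly_connected_invariant_set:
  assumes "\<not> strongly_connected {..<n} {..<k} \<delta>"
  shows "\<exists>Y \<subseteq> {..<n}. Y \<noteq> {} \<and> Y \<noteq> {..<n} \<and> (r0 \<in> Y \<longrightarrow> r1 \<in> Y) \<and>
    (\<forall>a\<in>{1..<k}. B a ` Y = Y) \<and> \<sigma> ` (Y - {r0}) = Y - {r0}"
proof -
  obtain p q where pq: "p < n" "q < n" "\<And>u. u \<in> lists {..<k} \<Longrightarrow> run \<delta> p u \<noteq> q"
    using assms by (auto simp: strongly_connected_def)
  define Y where "Y = {run \<delta> p u |u. u \<in> lists {..<k}}"
  have YX: "Y \<subseteq> {..<n}" using run_in pq by (auto simp: Y_def)
  have step: "\<delta> (x, a) \<in> Y" if "x \<in> Y" "a \<in> {..<k}" for x a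
  proof -
    obtain u where "u \<in> lists {..<k}" "x = run \<delta> p u" using \<open>x \<in> Y\<close> by (auto simp: Y_def)
    then have "\<delta> (x, a) = run \<delta> p (u @ [a])" "u @ [a] \<in> lists {..<k}" using that by auto
    then show ?thesis unfolding Y_def by blast
  qed
  have fin: "finite Y" using YX finite_subset by blast
  have onto: "f ` A = A" if "finite A" "f ` A \<subseteq> A" "inj f" for f :: "nat \<Rightarrow> nat" and A
    using that by (meson endo_inj_surj inj_on_subset subset_UNIV)
  have B': "B a ` Y = Y" if a: "a \<in> {1..<k}" for a
    using fin step[of _ a] a YX permutes_inj[OF B[OF a]]
    by (intro onto) (force simp: \<delta>_Suc[symmetric])+
  have \<sigma>': "\<sigma> ` (Y - {r0}) = Y - {r0}"
  proof (rule onto)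
    show "\<sigma> ` (Y - {r0}) \<subseteq> Y - {r0}"
    proof
      fix z assume "z \<in> \<sigma> ` (Y - {r0})"
      then obtain x where x: "x \<in> Y" "x \<noteq> r0" "z = \<sigma> x" by blast
      then have "z = \<delta> (x, 0)" using YX \<delta>_0 by auto
      then show "z \<in> Y - {r0}" using step[of x 0] \<delta>_0_in[of x] x k YX by auto
    qed
  qed (use fin permutes_inj[OF \<sigma>] in auto)
  \<comment> \<open>The common image \<open>\<sigma> r1\<close> lies in \<open>Y - {r0}\<close>, on
    which \<open>\<sigma>\<close> is onto; injectivity of \<open>\<sigma>\<close> pulls
    \<open>r1\<close> back into \<open>Y\<close>.\<close>
  have "r1 \<in> Y" if "r0 \<in> Y"
  proof -
    have "\<delta> (r0, 0) \<in> Y" using step[of r0 0] that k by simp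
    then have "\<sigma> r1 \<in> Y - {r0}" using \<delta>_0_in[OF r0] r0 by (simp add: \<delta>_0)
    then have "\<sigma> r1 \<in> \<sigma> ` (Y - {r0})" using \<sigma>' by simp
    then show ?thesis using permutes_inj[OF \<sigma>] by (auto dest: injD)
  qed
  moreover have "p \<in> Y" unfolding Y_def by (auto intro: exI[of _ "[]"])
  moreover have "q \<notin> Y" using pq(3) by (auto simp: Y_def)
  ultimately show ?thesis using YX B' \<sigma>' pq(2) by (intro exI[of _ Y]) auto
qed

text \<open>Of the invariant set and its complement, the one without \<open>r0\<close> is chosen. It
  also avoids \<open>r1\<close>, so the letters act on it independently of how they act on the
  pair.\<close>

lemma not_strongly_connected_pair_invariant_set:
  assumes nsc: "\<not> strongly_connected {..<n} {..<k} \<delta>"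
    and inv: "\<And>a. a \<in> {1..<k} \<Longrightarrow> B a ` {r0, r1} = {r0, r1}"
    and moves: "a \<in> {1..<k}" "B a r0 \<noteq> r0"
  shows "\<exists>Z \<subseteq> {..<n} - {r0, r1}. Z \<noteq> {} \<and> (\<forall>a\<in>{1..<k}. B a ` Z = Z) \<and> \<sigma> ` Z = Z"
proof -
  obtain Y where Y: "Y \<subseteq> {..<n}" "Y \<noteq> {}" "Y \<noteq> {..<n}" "r0 \<in> Y \<longrightarrow> r1 \<in> Y"
    "\<forall>a\<in>{1..<k}. B a ` Y = Y" "\<sigma> ` (Y - {r0}) = Y - {r0}"
    using not_strongly_connected_invariant_set[OF nsc] by blast
  show ?thesis
  proof (cases "r0 \<in> Y")
    case True
    have "B a ` ({..<n} - Y) = {..<n} - Y" if "a \<in> {1..<k}" for a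
      using image_set_diff[OF permutes_inj[OF B[OF that]], of "{..<n}" Y]
        permutes_image[OF B[OF that]] Y(5) that by simp
    moreover have "\<sigma> ` ({..<n} - Y) = {..<n} - Y"
    proof -
      have "{..<n} - Y = ({..<n} - {r0}) - (Y - {r0})" using True by auto
      then show ?thesis
        using image_set_diff[OF permutes_inj[OF \<sigma>], of "{..<n} - {r0}" "Y - {r0}"]
          permutes_image[OF \<sigma>] Y(6) by simp
    qed
    moreover have "{..<n} - Y \<subseteq> {..<n} - {r0, r1}" "{..<n} - Y \<noteq> {}" using True Y by auto
    ultimately show ?thesis by blast
  next
    case False
    have "B a ` {r0, r1} = {r0, r1}" using inv moves by blast
    \<comment> \<open>A letter that preserves the pair and moves \<open>r0\<close> swaps the two
      states, so an invariant set without \<open>r0\<close> cannot contain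
      \<open>r1\<close>.\<close>
    then have "B a r1 = r0" using moves by (auto simp: doubleton_eq_iff)
    then have "r1 \<notin> Y" using False Y(5) moves(1) by (metis imageI)
    then show ?thesis using Y False by (intro exI[of _ Y]) auto
  qed
qed

end

section \<open>Parametrization of almost-group automata\<close>

definition params :: "nat \<Rightarrow> nat \<Rightarrow> (nat \<times> nat \<times> (nat \<Rightarrow> nat) \<times> (nat \<Rightarrow> nat \<Rightarrow> nat)) set" where
  "params n k = (SIGMA r0:{..<n}. SIGMA r1:{..<n} - {r0}.
     {\<sigma>. \<sigma> permutes {..<n} - {r0}} \<times> ({1..<k} \<rightarrow>\<^sub>E {\<tau>. \<tau> permutes {..<n}}))"

text \<open>
  The letter \<open>0\<close> fuses \<open>r0\<close> with \<open>r1\<close> and then permutes the states other than \<open>r0\<close>, which is its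
  unique non-cyclic point.
\<close>

definition encode ::
  "nat \<Rightarrow> nat \<Rightarrow> nat \<times> nat \<times> (nat \<Rightarrow> nat) \<times> (nat \<Rightarrow> nat \<Rightarrow> nat) \<Rightarrow> nat \<times> nat \<Rightarrow> nat" where
  "encode n k = (\<lambda>(r0, r1, \<sigma>, B).
     restrict (\<lambda>(q, a). if a = 0 then \<sigma> (if q = r0 then r1 else q) else B a q) ({..<n} \<times> {..<k}))"

lemma encode_almost_group_automaton:
  assumes "2 \<le> k" "(r0, r1, \<sigma>, B) \<in> params n k"
  shows "almost_group_automaton n k r0 r1 \<sigma> B (encode n k (r0, r1, \<sigma>, B))"
  using assms by unfold_locales (auto simp: params_def encode_def PiE_iff)

lemma finite_params: "finite (params n k)"
  unfolding params_def by (auto intro!: finite_SigmaI finite_PiE simp: finite_permutations)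

context almost_group_automaton
begin

lemma image_\<delta>_0: "(\<lambda>q. \<delta> (q, 0)) ` {..<n} = {..<n} - {r0}"
proof -
  have "(\<lambda>q. \<delta> (q, 0)) ` {..<n} = \<sigma> ` (\<lambda>q. if q = r0 then r1 else q) ` {..<n}"
    by (auto simp: \<delta>_0 image_image)
  also have "(\<lambda>q. if q = r0 then r1 else q) ` {..<n} = {..<n} - {r0}"
    using r1 r01 by auto
  finally show ?thesis using permutes_image[OF \<sigma>] by simp
qed

lemma funpow_\<delta>_0: "q < n \<Longrightarrow> q \<noteq> r0 \<Longrightarrow> ((\<lambda>q. \<delta> (q, 0)) ^^ l) q = (\<sigma> ^^ l) q \<and> (\<sigma> ^^ l) q < n \<and> (\<sigma> ^^ l) q \<noteq> r0"
  by (induction l) (auto simp: \<delta>_0 \<sigma>_in)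

lemma almost_permutation_\<delta>_0: "almost_permutation n (\<lambda>q. \<delta> (q, 0))"
proof -
  have "cyclic_point (\<lambda>q. \<delta> (q, 0)) x" if "x < n" "x \<noteq> r0" for x
  proof -
    obtain l where l: "\<sigma> ^^ l = id" "l > 0" by (rule \<sigma>_nilpotent)
    then show ?thesis
      using funpow_\<delta>_0[OF that, of l] unfolding cyclic_point_def by (auto intro!: exI[of _ l])
  qed
  moreover have "\<not> cyclic_point (\<lambda>q. \<delta> (q, 0)) r0"
  proof
    assume "cyclic_point (\<lambda>q. \<delta> (q, 0)) r0"
    then obtain l where l: "((\<lambda>q. \<delta> (q, 0)) ^^ Suc l) r0 = r0"
      unfolding cyclic_point_def by (auto simp: Suc_le_eq gr0_conv_Suc simp del: funpow.simps)
    have "((\<lambda>q. \<delta> (q, 0)) ^^ l) (\<delta> (r0, 0)) = r0" using l by (simp only: funpow_Suc_right o_apply)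
    then show False using funpow_\<delta>_0[of "\<delta> (r0, 0)" l] \<delta>_0_in[OF r0] by simp
  qed
  ultimately have "{x \<in> {..<n}. cyclic_point (\<lambda>q. \<delta> (q, 0)) x} = {..<n} - {r0}" by auto
  then show ?thesis using r0 \<delta>_0_in by (auto simp: almost_permutation_def)
qed

end

lemma encode_in:
  assumes k: "2 \<le> k" and t: "t \<in> params n k"
  shows "encode n k t \<in> almost_group_automata n k"
proof -
  obtain r0 r1 \<sigma> B where tt: "t = (r0, r1, \<sigma>, B)" by (cases t)
  interpret almost_group_automaton n k r0 r1 \<sigma> B "encode n k t"
    using encode_almost_group_automaton[OF k t[unfolded tt]] unfolding tt .
  have "encode n k t \<in> {..<n} \<times> {..<k} \<rightarrow>\<^sub>E {..<n}"
  proof (rule PiE_I)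
    show "encode n k t x \<in> {..<n}" if "x \<in> {..<n} \<times> {..<k}" for x
      using that \<delta>_in by auto
    show "encode n k t x = undefined" if "x \<notin> {..<n} \<times> {..<k}" for x
      using that by (simp add: encode_def tt split_beta restrict_def)
  qed
  moreover have "bij_betw (\<lambda>q. encode n k t (q, a)) {..<n} {..<n}" if "a \<in> {1..<k}" for a
    using permutes_imp_bij[OF B[OF that]]
    by (rule bij_betw_cong[THEN iffD1, rotated]) (use that \<delta>_Suc in auto)
  ultimately show ?thesis
    using r0 almost_permutation_\<delta>_0 by (auto simp: almost_group_automata_def automata_def)
qed

text \<open>The parameters can be read off: \<open>r0\<close> is the only state missing from the
  image of the letter \<open>0\<close>, \<open>\<sigma>\<close> is this letter off
  \<open>r0\<close>, and \<open>r1\<close> is the preimage under \<open>\<sigma>\<close> of the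
  image of \<open>r0\<close>.\<close>

lemma inj_on_encode:
  assumes k: "2 \<le> k"
  shows "inj_on (encode n k) (params n k)"
proof (rule inj_onI)
  fix t t' assume t: "t \<in> params n k" and t': "t' \<in> params n k" and eq: "encode n k t = encode n k t'"
  obtain r0 r1 \<sigma> B where tt: "t = (r0, r1, \<sigma>, B)" by (cases t)
  obtain r0' r1' \<sigma>' B' where tt': "t' = (r0', r1', \<sigma>', B')" by (cases t')
  interpret A: almost_group_automaton n k r0 r1 \<sigma> B "encode n k t"
    using encode_almost_group_automaton[OF k t[unfolded tt]] unfolding tt .
  interpret A': almost_group_automaton n k r0' r1' \<sigma>' B' "encode n k t"
    using encode_almost_group_automaton[OF k t'[unfolded tt']] unfolding eq tt' .
  have "{..<n} - {r0} = {..<n} - {r0'}" using A.image_\<delta>_0 A'.image_\<delta>_0 by simp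
  then have r: "r0' = r0" using A.r0 A'.r0 by blast
  have \<sigma>: "\<sigma>' = \<sigma>"
  proof
    fix q
    show "\<sigma>' q = \<sigma> q"
      using A.\<delta>_0[of q] A'.\<delta>_0[of q] permutes_not_in[OF A.\<sigma>, of q] permutes_not_in[OF A'.\<sigma>, of q]
      by (cases "q < n \<and> q \<noteq> r0") (auto simp: r)
  qed
  have "\<sigma> r1 = \<sigma> r1'" using A.\<delta>_0[OF A.r0] A'.\<delta>_0[OF A.r0] by (simp add: r \<sigma>)
  then have r1: "r1' = r1" using permutes_inj[OF A.\<sigma>] by (auto dest: injD)
  have "B' = B"
  proof
    fix a
    show "B' a = B a"
    proof (cases "a \<in> {1..<k}")
      case True
      show ?thesis
      proof
        fix q
        show "B' a q = B a q"
          using A.\<delta>_Suc[of q a] A'.\<delta>_Suc[of q a] True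
            permutes_not_in[OF A.B[OF True], of q] permutes_not_in[OF A'.B[OF True], of q]
          by (cases "q < n") auto
      qed
    next
      case False
      then show ?thesis using t t' unfolding tt tt' params_def by (auto simp: PiE_iff extensional_def)
    qed
  qed
  then show "t = t'" by (simp add: tt tt' r \<sigma> r1)
qed

lemma cyclic_point_image: "cyclic_point f x \<Longrightarrow> cyclic_point f (f x)"
  unfolding cyclic_point_def by (auto simp: funpow_swap1[symmetric])

text \<open>Two cyclic points have a common period \<open>N\<close>, and applying \<open>f\<close>
  another \<open>N - 1\<close> times recovers each of them from its image.\<close>

lemma inj_on_cyclic_points: "inj_on f {x. cyclic_point f x}"
proof (rule inj_onI)
  fix x y assume "x \<in> {x. cyclic_point f x}" "y \<in> {x. cyclic_point f x}" and eq: "f x = f y"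
  then obtain l l' where l: "(f ^^ Suc l) x = x" "(f ^^ Suc l') y = y"
    unfolding cyclic_point_def by (auto simp: Suc_le_eq gr0_conv_Suc simp del: funpow.simps)
  have pow: "(f ^^ (N * m)) z = z" if "(f ^^ N) z = z" for N m z
    using that by (induction m) (auto simp: funpow_add)
  define N where "N = Suc l * Suc l'"
  have "(f ^^ N) x = x" "(f ^^ N) y = y"
    using pow[OF l(1), of "Suc l'"] pow[OF l(2), of "Suc l"] by (simp_all only: N_def mult.commute)
  moreover obtain M where "N = Suc M" by (cases N) (auto simp: N_def)
  ultimately have "x = (f ^^ M) (f x)" "y = (f ^^ M) (f y)"
    by (simp_all only: funpow_Suc_right o_apply)
  then show "x = y" using eq by simp
qed

text \<open>The letter \<open>0\<close> permutes its set \<open>C\<close> of cyclic points, which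
  misses exactly one state \<open>r0\<close>. As \<open>r0\<close> is not fixed, its image lies in
  \<open>C\<close> and has a unique preimage \<open>r1\<close> in \<open>C\<close>.\<close>

lemma encode_surj:
  assumes k: "2 \<le> k" and \<delta>: "\<delta> \<in> almost_group_automata n k"
  shows "\<delta> \<in> encode n k ` params n k"
proof -
  define f where "f = (\<lambda>q. \<delta> (q, 0))"
  define C where "C = {x \<in> {..<n}. cyclic_point f x}"
  have PiE: "\<delta> \<in> {..<n} \<times> {..<k} \<rightarrow>\<^sub>E {..<n}" and fX: "f \<in> {..<n} \<rightarrow> {..<n}"
    and C: "Suc (card C) = n" and bij: "\<And>a. a \<in> {1..<k} \<Longrightarrow> bij_betw (\<lambda>q. \<delta> (q, a)) {..<n} {..<n}"
    using \<delta> by (auto simp: almost_group_automata_def automata_def almost_permutation_def C_def f_def)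
  have "card ({..<n} - C) = 1" using C by (subst card_Diff_subset) (auto simp: C_def)
  then obtain r0 where r0: "{..<n} - C = {r0}" by (auto simp: card_1_singleton_iff)
  have r0n: "r0 < n" and r0C: "r0 \<notin> C" using r0 by auto
  have CX: "C = {..<n} - {r0}" using r0 r0C by (auto simp: C_def)
  have fC: "f ` C \<subseteq> C" using fX by (auto simp: C_def intro: cyclic_point_image)
  have injC: "inj_on f C" by (rule inj_on_subset[OF inj_on_cyclic_points]) (auto simp: C_def)
  have fC': "f ` C = C" using fC injC by (intro endo_inj_surj) (auto simp: C_def)
  have "f r0 \<noteq> r0"
  proof
    assume "f r0 = r0"
    then have "cyclic_point f r0" unfolding cyclic_point_def by (auto intro!: exI[of _ 1])
    then show False using r0C r0n by (simp add: C_def)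
  qed
  then have "f r0 \<in> C" using fX r0n CX by auto
  then obtain r1 where r1: "r1 \<in> C" "f r1 = f r0" using fC' by (metis imageE)
  define \<sigma> where "\<sigma> = (\<lambda>q. if q \<in> C then f q else q)"
  define B where "B = restrict (\<lambda>a q. if q < n then \<delta> (q, a) else q) {1..<k}"
  have "bij_betw \<sigma> C C"
    by (rule bij_betw_cong[THEN iffD1, of C f]) (use fC' injC in \<open>auto simp: \<sigma>_def bij_betw_def\<close>)
  then have \<sigma>: "\<sigma> permutes C" by (rule bij_imp_permutes) (simp add: \<sigma>_def)
  have B: "B a permutes {..<n}" if "a \<in> {1..<k}" for a
  proof (rule bij_imp_permutes)
    show "bij_betw (B a) {..<n} {..<n}"
      using bij[OF that] by (rule bij_betw_cong[THEN iffD1, rotated]) (use that in \<open>simp add: B_def\<close>)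
  qed (use that in \<open>simp add: B_def\<close>)
  have t: "(r0, r1, \<sigma>, B) \<in> params n k"
    using r0n r1 \<sigma> B by (auto simp: params_def CX B_def)
  interpret A: almost_group_automaton n k r0 r1 \<sigma> B "encode n k (r0, r1, \<sigma>, B)"
    by (rule encode_almost_group_automaton[OF k t])
  have "\<delta> = encode n k (r0, r1, \<sigma>, B)"
  proof (rule extensionalityI[of _ "{..<n} \<times> {..<k}"])
    show "\<delta> \<in> extensional ({..<n} \<times> {..<k})" using PiE by (simp add: PiE_iff)
    show "encode n k (r0, r1, \<sigma>, B) \<in> extensional ({..<n} \<times> {..<k})" by (simp add: encode_def)
    fix x assume "x \<in> {..<n} \<times> {..<k}"
    then obtain q a where x: "x = (q, a)" "q < n" "a \<in> {..<k}" by auto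
    from x(3) show "\<delta> x = encode n k (r0, r1, \<sigma>, B) x"
    proof (cases rule: A.letter_cases)
      case zero
      then have "encode n k (r0, r1, \<sigma>, B) x = \<sigma> (if q = r0 then r1 else q)"
        using x by (simp only: A.\<delta>_0)
      also have "\<dots> = f q" using x r1 r0C by (auto simp: \<sigma>_def CX)
      finally show ?thesis using x zero by (simp add: f_def)
    next
      case perm
      then have "encode n k (r0, r1, \<sigma>, B) x = B a q" using x by (simp only: A.\<delta>_Suc)
      then show ?thesis using x perm by (simp add: B_def)
    qed
  qed
  then show ?thesis using t by blast
qed

text \<open>Counts move to the parameters, where \<open>\<sigma>\<close> and the letters
  \<open>B a\<close> vary independently once \<open>r0\<close> and \<open>r1\<close> are
  chosen.\<close>

lemma card_almost_group_automata_Collect: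
  assumes "2 \<le> k"
  shows "card {\<delta> \<in> almost_group_automata n k. P \<delta>} = card {t \<in> params n k. P (encode n k t)}"
proof -
  have "encode n k ` {t \<in> params n k. P (encode n k t)} = {\<delta> \<in> almost_group_automata n k. P \<delta>}"
    using encode_in[OF assms, of _ n] encode_surj[OF assms, of _ n] by blast
  moreover have "card (encode n k ` {t \<in> params n k. P (encode n k t)}) = card {t \<in> params n k. P (encode n k t)}"
    by (rule card_image, rule inj_on_subset[OF inj_on_encode[OF assms]]) blast
  ultimately show ?thesis by (simp only:)
qed

text \<open>The common frame of the union bounds: \<open>W\<close> collects the admissible pairs
  \<open>(\<sigma>, B)\<close> over fixed \<open>r0\<close>, \<open>r1\<close>, and \<open>w\<close>
  bounds it uniformly over the \<open>n (n - 1)\<close> choices.\<close>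

lemma card_params_le:
  assumes sub: "\<And>r0 r1 \<sigma> B. (r0, r1, \<sigma>, B) \<in> params n k \<Longrightarrow> P (r0, r1, \<sigma>, B) \<Longrightarrow> (\<sigma>, B) \<in> W r0 r1"
    and W: "\<And>r0 r1. r0 < n \<Longrightarrow> r1 < n \<Longrightarrow> r0 \<noteq> r1 \<Longrightarrow> finite (W r0 r1)"
      "\<And>r0 r1. r0 < n \<Longrightarrow> r1 < n \<Longrightarrow> r0 \<noteq> r1 \<Longrightarrow> real (card (W r0 r1)) \<le> w"
  shows "real (card {t \<in> params n k. P t}) \<le> real n * real (n - 1) * w"
proof -
  let ?S = "SIGMA r0:{..<n}. SIGMA r1:{..<n} - {r0}. W r0 r1"
  have fin: "finite ?S" using W(1) by (auto intro!: finite_SigmaI)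
  have "{t \<in> params n k. P t} \<subseteq> ?S"
  proof
    fix t assume "t \<in> {t \<in> params n k. P t}"
    moreover obtain r0 r1 \<sigma> B where "t = (r0, r1, \<sigma>, B)" by (cases t)
    ultimately show "t \<in> ?S" using sub[of r0 r1 \<sigma> B] by (simp add: params_def)
  qed
  then have "card {t \<in> params n k. P t} \<le> card ?S" using fin card_mono by blast
  also have "card ?S = (\<Sum>r0<n. \<Sum>r1\<in>{..<n} - {r0}. card (W r0 r1))"
  proof -
    have "card (Sigma ({..<n} - {r0}) (W r0)) = (\<Sum>r1\<in>{..<n} - {r0}. card (W r0 r1))" if "r0 < n" for r0
      using W(1) that by (intro card_SigmaI) auto
    then show ?thesis
      using W(1) by (subst card_SigmaI) (auto intro!: finite_SigmaI sum.cong)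
  qed
  finally have "real (card {t \<in> params n k. P t}) \<le> real (\<Sum>r0<n. \<Sum>r1\<in>{..<n} - {r0}. card (W r0 r1))"
    by (simp only: of_nat_le_iff)
  also have "\<dots> = (\<Sum>r0<n. \<Sum>r1\<in>{..<n} - {r0}. real (card (W r0 r1)))" by simp
  also have "\<dots> \<le> (\<Sum>r0<n. \<Sum>r1\<in>{..<n} - {r0}. w)"
    using W(2) by (intro sum_mono) auto
  also have "\<dots> = real n * real (n - 1) * w"
    by (cases n) (simp_all add: card_Diff_singleton)
  finally show ?thesis .
qed

lemma card_PiE_const: "card ({1..<k} \<rightarrow>\<^sub>E S) = card S ^ (k - 1)"
  by (simp add: card_PiE)

lemma card_params: "card (params n k) = n * (n - 1) * (fact (n - 1) * fact n ^ (k - 1))"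
proof -
  have "card {\<sigma>. \<sigma> permutes {..<n} - {r0}} = fact (n - 1)" if "r0 < n" for r0
    using card_permutations[of "{..<n} - {r0}" "n - 1"] that by (simp add: card_Diff_singleton)
  moreover have "card ({1..<k} \<rightarrow>\<^sub>E {\<tau>. \<tau> permutes {..<n}}) = fact n ^ (k - 1)"
    unfolding card_PiE_const by (simp add: card_permutations[OF refl])
  ultimately have "card ({\<sigma>. \<sigma> permutes {..<n} - {r0}} \<times> ({1..<k} \<rightarrow>\<^sub>E {\<tau>. \<tau> permutes {..<n}})) =
      fact (n - 1) * fact n ^ (k - 1)" if "r0 < n" for r0
    using that unfolding card_cartesian_product by simp
  then show ?thesis
    unfolding params_def
    by (simp add: card_SigmaI finite_SigmaI finite_PiE finite_permutations card_Diff_singleton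
        del: One_nat_def)
qed

section \<open>Connectivity and invariant pairs\<close>

lemma sum_Pow_card:
  assumes "finite A"
  shows "(\<Sum>T\<in>Pow A. f (card T)) = (\<Sum>i\<le>card A. real (card A choose i) * f i)"
proof -
  have "(\<Sum>T\<in>Pow A. f (card T)) = (\<Sum>i\<le>card A. \<Sum>T\<in>{T \<in> Pow A. card T = i}. f (card T))"
    using assms by (intro sum.group[symmetric]) (auto intro: card_mono)
  also have "\<dots> = (\<Sum>i\<le>card A. real (card {T \<in> Pow A. card T = i}) * f i)"
    by (intro sum.cong refl) simp
  also have "\<dots> = (\<Sum>i\<le>card A. real (card A choose i) * f i)"
    using n_subsets[OF assms] by simp
  finally show ?thesis .
qed

lemma card_permutes_invariant_le:
  assumes "finite X" "S \<subseteq> X"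
  shows "real (card {\<tau>. \<tau> permutes X \<and> \<tau> ` S = S}) \<le> fact (card X) / real (card X choose card S)"
proof -
  have "real (card {\<tau>. \<tau> permutes X \<and> \<tau> ` S = S}) \<le> real (fact (card S) * fact (card X - card S))"
    using card_permutes_image_le[OF assms] by (simp only: of_nat_le_iff)
  also have "\<dots> = fact (card X) / real (card X choose card S)"
    using card_mono[OF assms] by (simp add: binomial_fact)
  finally show ?thesis .
qed

text \<open>The number of sets of size \<open>i\<close> cancels the proportion of permutations
  preserving one of them. The union over all sets thus costs only a sum over sizes.\<close>

lemma sum_Pow_card_permutes_invariant_le:
  assumes "finite A" "\<And>i. 0 \<le> g i"
  shows "(\<Sum>T\<in>Pow A. real (card {\<sigma>. \<sigma> permutes A \<and> \<sigma> ` T = T}) * g (card T))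
    \<le> fact (card A) * (\<Sum>i\<le>card A. g i)"
proof -
  have "(\<Sum>T\<in>Pow A. real (card {\<sigma>. \<sigma> permutes A \<and> \<sigma> ` T = T}) * g (card T))
    \<le> (\<Sum>T\<in>Pow A. fact (card A) / real (card A choose card T) * g (card T))"
    using assms by (intro sum_mono mult_right_mono card_permutes_invariant_le) auto
  also have "\<dots> = (\<Sum>i\<le>card A. real (card A choose i) * (fact (card A) / real (card A choose i) * g i))"
    by (rule sum_Pow_card[OF assms(1)])
  also have "\<dots> = fact (card A) * (\<Sum>i\<le>card A. g i)"
    unfolding sum_distrib_left by (intro sum.cong) auto
  finally show ?thesis .
qed

text \<open>Summed over the sizes \<open>j\<close> of proper nonempty sets, each term is the
  proportion of permutations of \<open>n\<close> points that preserve a given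
  \<open>j\<close>-element set.\<close>

definition inv_binom_sum :: "nat \<Rightarrow> real" where
  "inv_binom_sum n = (\<Sum>j = 1..<n. 1 / real (n choose j))"

lemma card_PiE_invariant_le:
  assumes "finite X" "S \<subseteq> X" "2 \<le> k"
  shows "real (card ({1..<k} \<rightarrow>\<^sub>E {\<tau>. \<tau> permutes X \<and> \<tau> ` S = S}))
    \<le> fact (card X) ^ (k - 1) / real (card X choose card S)"
proof -
  define b where "b = real (card X choose card S)"
  have b: "1 \<le> b" using card_mono[OF assms(1,2)] by (simp add: Suc_le_eq b_def)
  have "real (card ({1..<k} \<rightarrow>\<^sub>E {\<tau>. \<tau> permutes X \<and> \<tau> ` S = S}))
      = real (card {\<tau>. \<tau> permutes X \<and> \<tau> ` S = S}) ^ (k - 1)"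
    unfolding card_PiE_const by simp
  also have "\<dots> \<le> (fact (card X) / b) ^ (k - 1)"
    unfolding b_def by (intro power_mono card_permutes_invariant_le assms) simp
  also have "\<dots> = fact (card X) ^ (k - 1) / b ^ (k - 1)" by (simp add: power_divide)
  \<comment> \<open>One of the \<open>k - 1\<close> factors \<open>b\<close> is kept;
    \<open>k \<ge> 2\<close> guarantees that there is one.\<close>
  also have "\<dots> \<le> fact (card X) ^ (k - 1) / b ^ 1"
    using b assms(3) by (intro divide_left_mono power_increasing mult_pos_pos) auto
  finally show ?thesis by (simp add: b_def)
qed

lemma finite_PiE_permutes:
  "finite X \<Longrightarrow> S \<subseteq> {\<tau>. \<tau> permutes X} \<Longrightarrow> finite ({1..<k::nat} \<rightarrow>\<^sub>E S)"
  by (rule finite_PiE) (auto intro: finite_subset[OF _ finite_permutations])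

text \<open>An invariant \<open>Y\<close> is \<open>T\<close> or \<open>insert r0 T\<close>, where
  \<open>T = Y - {r0}\<close> is preserved by \<open>\<sigma>\<close>. The choices of
  \<open>\<sigma>\<close> absorb the choice of \<open>T\<close>, and the permutation letters leave
  one reciprocal binomial for each of the two candidates, whence the factor 2.\<close>

lemma card_not_strongly_connected_le:
  assumes k: "2 \<le> k"
  shows "real (card {t \<in> params n k. \<not> strongly_connected {..<n} {..<k} (encode n k t)})
    \<le> real n * real (n - 1) * (fact (n - 1) * fact n ^ (k - 1) * (2 * inv_binom_sum n))"
proof -
  let ?X = "{..<n}"
  let ?S = "\<lambda>r0 T. {\<sigma>. \<sigma> permutes ?X - {r0} \<and> \<sigma> ` T = T}"
  let ?P = "\<lambda>Y. {1..<k} \<rightarrow>\<^sub>E {\<tau>. \<tau> permutes ?X \<and> \<tau> ` Y = Y}"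
  let ?Ys = "\<lambda>r0 T. {Y \<in> {T, insert r0 T}. Y \<noteq> {} \<and> Y \<noteq> ?X}"
  let ?W = "\<lambda>r0 r1. \<Union>T\<in>Pow (?X - {r0}). ?S r0 T \<times> (\<Union>Y\<in>?Ys r0 T. ?P Y)"
  have sub: "(\<sigma>, B) \<in> ?W r0 r1" if t: "(r0, r1, \<sigma>, B) \<in> params n k"
      and nsc: "\<not> strongly_connected ?X {..<k} (encode n k (r0, r1, \<sigma>, B))" for r0 r1 \<sigma> B
  proof -
    interpret almost_group_automaton n k r0 r1 \<sigma> B "encode n k (r0, r1, \<sigma>, B)"
      by (rule encode_almost_group_automaton[OF k t])
    obtain Y where Y: "Y \<subseteq> ?X" "Y \<noteq> {}" "Y \<noteq> ?X"
      "\<forall>a\<in>{1..<k}. B a ` Y = Y" "\<sigma> ` (Y - {r0}) = Y - {r0}"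
      using not_strongly_connected_invariant_set[OF nsc] by blast
    have "B \<in> ?P Y" using t Y(5) Y(4) by (auto simp: params_def PiE_iff)
    moreover have "Y \<in> ?Ys r0 (Y - {r0})" using Y by auto
    ultimately have "B \<in> (\<Union>Y'\<in>?Ys r0 (Y - {r0}). ?P Y')" by (rule UN_I[rotated])
    moreover have "\<sigma> \<in> ?S r0 (Y - {r0})" using \<sigma> Y(5) by simp
    ultimately show ?thesis using Y(1) by (intro UN_I[of "Y - {r0}"]) auto
  qed
  have fin: "finite (?W r0 r1)"
    and card: "real (card (?W r0 r1)) \<le> fact (n - 1) * fact n ^ (k - 1) * (2 * inv_binom_sum n)"
    if r: "r0 < n" "r1 < n" "r0 \<noteq> r1" for r0 r1
  proof -
    define A where "A = ?X - {r0}"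
    have A: "finite A" "card A = n - 1" using r by (auto simp: A_def card_Diff_singleton)
    have finS: "finite (?S r0 T)" for T
      by (rule finite_subset[OF _ finite_permutations[of "?X - {r0}"]]) auto
    have finP: "finite (?P Y)" for Y by (rule finite_PiE_permutes[of ?X]) auto
    show "finite (?W r0 r1)" using finS finP by (intro finite_UN_I finite_SigmaI) auto
    \<comment> \<open>The value 0 at the sizes 0 and \<open>n\<close> discards the empty and the
      full set, which every permutation preserves.\<close>
    define h where "h = (\<lambda>j. if 1 \<le> j \<and> j < n then 1 / real (n choose j) else 0)"
    have h0: "0 \<le> h j" for j by (simp add: h_def)
    have Pb: "real (card (?P Y)) \<le> fact n ^ (k - 1) * h (card Y)"
      if "Y \<subseteq> ?X" "Y \<noteq> {}" "Y \<noteq> ?X" for Y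
    proof -
      have "card Y < card ?X" using that by (intro psubset_card_mono) auto
      moreover have "card Y \<noteq> 0" using that finite_subset by fastforce
      ultimately show ?thesis
        using card_PiE_invariant_le[OF _ that(1) k] by (simp add: h_def Suc_le_eq del: One_nat_def)
    qed
    have UP: "real (card (\<Union>Y\<in>?Ys r0 T. ?P Y)) \<le> fact n ^ (k - 1) * (h (card T) + h (card T + 1))"
      if T: "T \<subseteq> A" for T
    proof -
      have finT: "finite T" and r0T: "r0 \<notin> T" and TX: "T \<subseteq> ?X" using T finite_subset[OF T A(1)] by (auto simp: A_def)
      have "real (card (\<Union>Y\<in>?Ys r0 T. ?P Y)) \<le> real (\<Sum>Y\<in>?Ys r0 T. card (?P Y))"
        by (intro of_nat_mono card_UN_le) simp
      also have "\<dots> = (\<Sum>Y\<in>?Ys r0 T. real (card (?P Y)))" by simp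
      also have "\<dots> \<le> (\<Sum>Y\<in>?Ys r0 T. fact n ^ (k - 1) * h (card Y))"
        using TX r by (intro sum_mono Pb) auto
      also have "\<dots> \<le> (\<Sum>Y\<in>{T, insert r0 T}. fact n ^ (k - 1) * h (card Y))"
        using h0 by (intro sum_mono2) auto
      also have "\<dots> = fact n ^ (k - 1) * (h (card T) + h (card T + 1))"
        using finT r0T by (subst sum.insert) (auto simp: algebra_simps)
      finally show ?thesis .
    qed
    have "real (card (?W r0 r1)) \<le> real (\<Sum>T\<in>Pow A. card (?S r0 T \<times> (\<Union>Y\<in>?Ys r0 T. ?P Y)))"
      unfolding A_def[symmetric] using A(1) by (intro of_nat_mono card_UN_le) simp
    also have "\<dots> = (\<Sum>T\<in>Pow A. real (card (?S r0 T)) * real (card (\<Union>Y\<in>?Ys r0 T. ?P Y)))"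
      by (simp add: card_cartesian_product)
    also have "\<dots> \<le> (\<Sum>T\<in>Pow A. real (card (?S r0 T)) * (fact n ^ (k - 1) * (h (card T) + h (card T + 1))))"
      by (intro sum_mono mult_left_mono UP) auto
    also have "\<dots> \<le> fact (card A) * (\<Sum>i\<le>card A. fact n ^ (k - 1) * (h i + h (i + 1)))"
      unfolding A_def[symmetric]
      by (rule sum_Pow_card_permutes_invariant_le[OF A(1), of "\<lambda>i. fact n ^ (k - 1) * (h i + h (i + 1))"])
        (simp add: h0)
    also have "(\<Sum>i\<le>card A. fact n ^ (k - 1) * (h i + h (i + 1)))
        = fact n ^ (k - 1) * ((\<Sum>i<n. h i) + (\<Sum>i<n. h (Suc i)))"
      using r(1) A(2) by (cases n) (simp_all add: sum_distrib_left[symmetric] sum.distrib lessThan_Suc_atMost)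
    also have "(\<Sum>i<n. h i) = inv_binom_sum n"
      unfolding inv_binom_sum_def by (rule sum.mono_neutral_cong_right) (auto simp: h_def)
    also have "(\<Sum>i<n. h (Suc i)) = inv_binom_sum n"
    proof -
      have "(\<Sum>i<n. h (Suc i)) = (\<Sum>j\<in>Suc ` {..<n}. h j)" by (simp add: sum.reindex)
      also have "\<dots> = inv_binom_sum n"
        unfolding inv_binom_sum_def
        by (rule sum.mono_neutral_cong_right) (auto simp: h_def image_Suc_lessThan)
      finally show ?thesis .
    qed
    finally show "real (card (?W r0 r1)) \<le> fact (n - 1) * fact n ^ (k - 1) * (2 * inv_binom_sum n)"
      by (simp add: A(2) algebra_simps)
  qed
  show ?thesis
    by (rule card_params_le[where W = ?W, OF sub fin card])
qed

section \<open>Automata in which the pair \<open>{r0, r1}\<close> is invariant\<close>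

definition pair_stab :: "'a set \<Rightarrow> 'a \<Rightarrow> 'a \<Rightarrow> ('a \<Rightarrow> 'a) set" where
  "pair_stab X x y = {\<tau>. \<tau> permutes X \<and> \<tau> ` {x, y} = {x, y}}"

lemma pair_stab_fixing:
  assumes "x \<in> X" "y \<in> X" "x \<noteq> y"
  shows "{\<tau> \<in> pair_stab X x y. \<tau> x = x} = {\<tau>. \<tau> permutes X - {x, y}}"
proof (intro equalityI subsetI)
  fix \<tau> assume "\<tau> \<in> {\<tau> \<in> pair_stab X x y. \<tau> x = x}"
  then have \<tau>: "\<tau> permutes X" "\<tau> ` {x, y} = {x, y}" "\<tau> x = x" by (auto simp: pair_stab_def)
  then have "\<tau> y = y" using assms(3) by (auto simp: doubleton_eq_iff)
  then have "\<tau> permutes X - {x, y}" using \<tau> by (intro permutes_superset[OF \<tau>(1)]) auto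
  then show "\<tau> \<in> {\<tau>. \<tau> permutes X - {x, y}}" by simp
next
  fix \<tau> assume "\<tau> \<in> {\<tau>. \<tau> permutes X - {x, y}}"
  then have \<tau>: "\<tau> permutes X - {x, y}" by simp
  then have "\<tau> x = x" "\<tau> y = y" by (auto intro: permutes_not_in)
  then show "\<tau> \<in> {\<tau> \<in> pair_stab X x y. \<tau> x = x}"
    using permutes_subset[OF \<tau>, of X] by (auto simp: pair_stab_def)
qed

text \<open>Composition with the transposition of \<open>x\<close> and \<open>y\<close> is an
  involution exchanging the permutations that fix both points with those that swap them. It acts
  trivially on \<open>Z\<close>. The case of empty \<open>Z\<close> gives the size of
  \<open>pair_stab\<close>.\<close>

lemma card_pair_stab_Collect:
  assumes X: "finite X" and xy: "x \<in> X" "y \<in> X" "x \<noteq> y" and Z: "Z \<subseteq> X - {x, y}"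
  shows "card {\<tau> \<in> pair_stab X x y. \<tau> ` Z = Z} = 2 * card {\<tau>. \<tau> permutes X - {x, y} \<and> \<tau> ` Z = Z}"
proof -
  let ?Q = "{\<tau>. \<tau> permutes X - {x, y} \<and> \<tau> ` Z = Z}"
  let ?t = "\<lambda>\<tau>. Transposition.transpose x y \<circ> \<tau>"
  have fix_xy: "\<tau> x = x" "\<tau> y = y" if "\<tau> \<in> ?Q" for \<tau> using that by (auto intro: permutes_not_in)
  have tt: "?t (?t \<tau>) = \<tau>" for \<tau> :: "'a \<Rightarrow> 'a" by (simp add: fun_eq_iff)
  have tZ: "?t \<tau> ` Z = Z" if "\<tau> ` Z = Z" for \<tau>
  proof -
    have "?t \<tau> ` Z = Transposition.transpose x y ` (\<tau> ` Z)" by (simp only: image_comp)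
    also have "\<dots> = Transposition.transpose x y ` Z" using that by (simp only:)
    also have "\<dots> = id ` Z" using Z by (intro image_cong) (auto simp: Transposition.transpose_def)
    finally show ?thesis by simp
  qed
  have tp: "?t \<tau> \<in> pair_stab X x y" if "\<tau> \<in> pair_stab X x y" for \<tau>
  proof -
    have "?t \<tau> permutes X" using that xy by (auto simp: pair_stab_def intro: permutes_compose permutes_swap_id)
    moreover have "?t \<tau> ` {x, y} = Transposition.transpose x y ` {x, y}"
    proof -
      have "?t \<tau> ` {x, y} = Transposition.transpose x y ` (\<tau> ` {x, y})" by (simp only: image_comp)
      moreover have "\<tau> ` {x, y} = {x, y}" using that unfolding pair_stab_def by blast
      ultimately show ?thesis by (simp only:)
    qed
    ultimately show ?thesis by (auto simp: pair_stab_def)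
  qed
  have Q: "?Q = {\<tau> \<in> pair_stab X x y. \<tau> x = x \<and> \<tau> ` Z = Z}"
    using pair_stab_fixing[OF xy] by blast
  have "{\<tau> \<in> pair_stab X x y. \<tau> ` Z = Z} = ?Q \<union> ?t ` ?Q"
  proof (intro equalityI subsetI)
    fix \<tau> assume "\<tau> \<in> {\<tau> \<in> pair_stab X x y. \<tau> ` Z = Z}"
    then have \<tau>: "\<tau> \<in> pair_stab X x y" "\<tau> ` Z = Z" by auto
    then have "\<tau> x \<in> {x, y}" unfolding pair_stab_def by (metis (mono_tags, lifting) imageI insertI1 mem_Collect_eq)
    then have "\<tau> x = x \<or> \<tau> x = y" by simp
    then show "\<tau> \<in> ?Q \<union> ?t ` ?Q"
    proof
      assume "\<tau> x = x"
      then show ?thesis using \<tau> unfolding Q by blast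
    next
      assume "\<tau> x = y"
      then have "?t \<tau> \<in> ?Q" using tp[OF \<tau>(1)] tZ[OF \<tau>(2)] unfolding Q by simp
      then have "?t (?t \<tau>) \<in> ?t ` ?Q" by (rule imageI)
      then show ?thesis unfolding tt by blast
    qed
  next
    fix \<tau> assume "\<tau> \<in> ?Q \<union> ?t ` ?Q"
    then show "\<tau> \<in> {\<tau> \<in> pair_stab X x y. \<tau> ` Z = Z}"
      unfolding Q using tp tZ by blast
  qed
  moreover have "?Q \<inter> ?t ` ?Q = {}"
  proof (rule ccontr)
    assume "?Q \<inter> ?t ` ?Q \<noteq> {}"
    then obtain \<tau> where "\<tau> \<in> ?Q" "?t \<tau> \<in> ?Q" by blast
    then show False using fix_xy(1)[of \<tau>] fix_xy(1)[of "?t \<tau>"] xy(3) by simp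
  qed
  moreover have "finite ?Q"
    using X by (intro finite_subset[OF _ finite_permutations[of "X - {x, y}"]]) auto
  moreover have "card (?t ` ?Q) = card ?Q"
    by (rule card_image, rule inj_on_inverseI[of _ ?t]) (rule tt)
  ultimately show ?thesis by (simp add: card_Un_disjoint)
qed

lemma card_pair_stab:
  assumes X: "finite X" and xy: "x \<in> X" "y \<in> X" "x \<noteq> y"
  shows "card (pair_stab X x y) = 2 * fact (card X - 2)"
proof -
  have "card (X - {x, y}) = card X - 2" using assms by (subst card_Diff_subset) auto
  then have "card {\<tau>. \<tau> permutes X - {x, y}} = fact (card X - 2)"
    using X by (intro card_permutations) auto
  then show ?thesis using card_pair_stab_Collect[OF X xy, of "{}"] by simp
qed

text \<open>Within \<open>pair_stab\<close>, fixing \<open>r0\<close> means fixing both points, so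
  the tuples in which no letter moves \<open>r0\<close> are exactly tuples of permutations of the
  other states.\<close>

definition moved_pair :: "nat \<Rightarrow> nat \<Rightarrow> nat \<Rightarrow> nat \<Rightarrow> (nat \<Rightarrow> nat \<Rightarrow> nat) set" where
  "moved_pair n k r0 r1 = ({1..<k} \<rightarrow>\<^sub>E pair_stab {..<n} r0 r1) - ({1..<k} \<rightarrow>\<^sub>E {\<tau>. \<tau> permutes {..<n} - {r0, r1}})"

lemma finite_moved_pair: "finite (moved_pair n k r0 r1)"
  unfolding moved_pair_def
  by (intro finite_Diff finite_PiE_permutes[of "{..<n}"]) (auto simp: pair_stab_def)

lemma card_moved_pair:
  assumes "r0 < n" "r1 < n" "r0 \<noteq> r1"
  shows "real (card (moved_pair n k r0 r1)) = (2 ^ (k - 1) - 1) * fact (n - 2) ^ (k - 1)"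
proof -
  let ?Q = "{\<tau>. \<tau> permutes {..<n} - {r0, r1}}"
  have sub: "?Q \<subseteq> pair_stab {..<n} r0 r1"
    using pair_stab_fixing[of r0 "{..<n}" r1] assms by auto
  have "card ({..<n} - {r0, r1}) = n - 2" using assms by (subst card_Diff_subset) auto
  then have cQ: "card ?Q = fact (n - 2)" by (intro card_permutations) auto
  have fin: "finite ({1..<k} \<rightarrow>\<^sub>E pair_stab {..<n} r0 r1)"
    by (intro finite_PiE_permutes[of "{..<n}"]) (auto simp: pair_stab_def)
  have PQ: "({1..<k} \<rightarrow>\<^sub>E ?Q) \<subseteq> ({1..<k} \<rightarrow>\<^sub>E pair_stab {..<n} r0 r1)"
    by (rule PiE_mono) (rule sub)
  have "real (card (moved_pair n k r0 r1)) =
     real (card ({1..<k} \<rightarrow>\<^sub>E pair_stab {..<n} r0 r1)) - real (card ({1..<k} \<rightarrow>\<^sub>E ?Q))"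
    unfolding moved_pair_def
    using card_mono[OF fin PQ] by (subst card_Diff_subset[OF finite_subset[OF PQ fin] PQ]) (rule of_nat_diff)
  also have "\<dots> = (2 * fact (n - 2)) ^ (k - 1) - fact (n - 2) ^ (k - 1)"
    using assms unfolding card_PiE_const cQ by (simp add: card_pair_stab)
  finally show ?thesis by (simp add: power_mult_distrib algebra_simps)
qed

definition moved_params :: "nat \<Rightarrow> nat \<Rightarrow> (nat \<times> nat \<times> (nat \<Rightarrow> nat) \<times> (nat \<Rightarrow> nat \<Rightarrow> nat)) set" where
  "moved_params n k = (SIGMA r0:{..<n}. SIGMA r1:{..<n} - {r0}.
     {\<sigma>. \<sigma> permutes {..<n} - {r0}} \<times> moved_pair n k r0 r1)"

lemma card_moved_params:
  "real (card (moved_params n k)) =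
    real n * real (n - 1) * (fact (n - 1) * ((2 ^ (k - 1) - 1) * fact (n - 2) ^ (k - 1)))"
proof -
  have "card {\<sigma>. \<sigma> permutes {..<n} - {r0}} = fact (n - 1)" if "r0 < n" for r0
    using card_permutations[of "{..<n} - {r0}" "n - 1"] that by (simp add: card_Diff_singleton)
  then have c: "real (card ({\<sigma>. \<sigma> permutes {..<n} - {r0}} \<times> moved_pair n k r0 r1)) =
      fact (n - 1) * ((2 ^ (k - 1) - 1) * fact (n - 2) ^ (k - 1))" if "r0 < n" "r1 < n" "r0 \<noteq> r1" for r0 r1
    using that card_moved_pair[OF that, of k] unfolding card_cartesian_product of_nat_mult by simp
  have fin: "finite ({\<sigma>. \<sigma> permutes {..<n} - {r0}} \<times> moved_pair n k r0 r1)" for r0 r1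
    by (intro finite_cartesian_product finite_permutations finite_moved_pair) auto
  have "real (card (moved_params n k)) = (\<Sum>r0<n. \<Sum>r1\<in>{..<n} - {r0}.
      real (card ({\<sigma>. \<sigma> permutes {..<n} - {r0}} \<times> moved_pair n k r0 r1)))"
    unfolding moved_params_def using fin by (subst card_SigmaI) (auto simp: card_SigmaI finite_SigmaI)
  also have "\<dots> = (\<Sum>r0<n. \<Sum>r1\<in>{..<n} - {r0}. fact (n - 1) * ((2 ^ (k - 1) - 1) * fact (n - 2) ^ (k - 1)))"
    by (intro sum.cong refl c) auto
  also have "\<dots> = real n * real (n - 1) * (fact (n - 1) * ((2 ^ (k - 1) - 1) * fact (n - 2) ^ (k - 1)))"
    by (cases n) (simp_all add: card_Diff_singleton)
  finally show ?thesis .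
qed

lemma moved_params_subset: "moved_params n k \<subseteq> params n k"
  unfolding moved_params_def params_def moved_pair_def
  by (auto simp: PiE_iff pair_stab_def)

text \<open>Here the roles are exchanged: the permutation letters, acting on \<open>n - 2\<close>
  states, absorb the number of sets \<open>Z\<close>, and \<open>\<sigma>\<close> contributes the
  small factor. This matters when \<open>Z\<close> consists of all states outside the pair: the
  letters preserve it automatically, while \<open>\<sigma>\<close>, acting on \<open>n - 1\<close>
  states, does so with probability \<open>1 / (n - 1)\<close>.\<close>

lemma card_moved_not_strongly_connected_le:
  assumes k: "2 \<le> k"
  shows "real (card {t \<in> params n k. t \<in> moved_params n k \<and> \<not> strongly_connected {..<n} {..<k} (encode n k t)})
    \<le> real n * real (n - 1) * (fact (n - 1) * ((2 * fact (n - 2)) ^ (k - 1) * inv_binom_sum (n - 1)))"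
proof -
  let ?X = "{..<n}"
  let ?S = "\<lambda>r0 Z. {\<sigma>. \<sigma> permutes ?X - {r0} \<and> \<sigma> ` Z = Z}"
  let ?P = "\<lambda>r0 r1 Z. {1..<k} \<rightarrow>\<^sub>E {\<tau> \<in> pair_stab ?X r0 r1. \<tau> ` Z = Z}"
  let ?W = "\<lambda>r0 r1. \<Union>Z\<in>Pow (?X - {r0, r1}) - {{}}. ?S r0 Z \<times> ?P r0 r1 Z"
  have sub: "(\<sigma>, B) \<in> ?W r0 r1" if t: "(r0, r1, \<sigma>, B) \<in> params n k"
      and P: "(r0, r1, \<sigma>, B) \<in> moved_params n k \<and> \<not> strongly_connected ?X {..<k} (encode n k (r0, r1, \<sigma>, B))"
    for r0 r1 \<sigma> B
  proof -
    interpret almost_group_automaton n k r0 r1 \<sigma> B "encode n k (r0, r1, \<sigma>, B)"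
      by (rule encode_almost_group_automaton[OF k t])
    have B: "B \<in> {1..<k} \<rightarrow>\<^sub>E pair_stab ?X r0 r1" "B \<notin> {1..<k} \<rightarrow>\<^sub>E {\<tau>. \<tau> permutes ?X - {r0, r1}}"
      using P by (simp_all add: moved_params_def moved_pair_def)
    have ps: "B a \<in> pair_stab ?X r0 r1" if "a \<in> {1..<k}" for a
      using PiE_mem[OF B(1) that] .
    have inv: "B a ` {r0, r1} = {r0, r1}" if "a \<in> {1..<k}" for a
      using ps[OF that] unfolding pair_stab_def by blast
    have "\<exists>a\<in>{1..<k}. B a \<notin> {\<tau>. \<tau> permutes ?X - {r0, r1}}"
      using B by (auto simp: PiE_iff)
    then obtain a where a: "a \<in> {1..<k}" "B a r0 \<noteq> r0"
      using pair_stab_fixing[of r0 ?X r1] ps r0 r1 r01 by blast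
    obtain Z where Z: "Z \<subseteq> ?X - {r0, r1}" "Z \<noteq> {}" "\<forall>a\<in>{1..<k}. B a ` Z = Z" "\<sigma> ` Z = Z"
      using not_strongly_connected_pair_invariant_set[OF conjunct2[OF P] inv a] by blast
    have "B \<in> ?P r0 r1 Z"
      using B(1) Z(3) by (auto simp: PiE_iff)
    moreover have "\<sigma> \<in> ?S r0 Z" using \<sigma> Z(4) by simp
    ultimately show ?thesis using Z(1,2) by (intro UN_I[of Z]) auto
  qed
  have fin: "finite (?W r0 r1)"
    and card: "real (card (?W r0 r1)) \<le> fact (n - 1) * ((2 * fact (n - 2)) ^ (k - 1) * inv_binom_sum (n - 1))"
    if r: "r0 < n" "r1 < n" "r0 \<noteq> r1" for r0 r1
  proof -
    define A where "A = ?X - {r0, r1}"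
    have A: "finite A" "card A = n - 2" using r by (auto simp: A_def card_Diff_subset)
    have n1: "card (?X - {r0}) = n - 1" using r by (simp add: card_Diff_singleton)
    have finS: "finite (?S r0 T)" for T
      by (rule finite_subset[OF _ finite_permutations[of "?X - {r0}"]]) auto
    have finP: "finite (?P r0 r1 Y)" for Y
      by (rule finite_PiE_permutes[of ?X]) (auto simp: pair_stab_def)
    show "finite (?W r0 r1)" using finS finP by (intro finite_UN_I finite_SigmaI) auto
    define C :: real where "C = fact (n - 1) * (2 * fact (n - 2)) ^ (k - 1)"
    \<comment> \<open>The value 0 at size 0 lets the sum run over all of \<open>Pow A\<close>
      although the empty set is excluded.\<close>
    define F where "F = (\<lambda>j. if 1 \<le> j then C / (real (n - 1 choose j) * real (n - 2 choose j)) else 0)"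
    have ZF: "real (card (?S r0 Z \<times> ?P r0 r1 Z)) \<le> F (card Z)" if Z: "Z \<in> Pow A - {{}}" for Z
    proof -
      have ZA: "Z \<subseteq> ?X - {r0, r1}" "finite Z" using Z A finite_subset by (auto simp: A_def)
      have "card (?P r0 r1 Z) = 2 ^ (k - 1) * card ({1..<k} \<rightarrow>\<^sub>E {\<tau>. \<tau> permutes A \<and> \<tau> ` Z = Z})"
        unfolding card_PiE_const
        using card_pair_stab_Collect[of ?X r0 r1 Z] r ZA(1) by (simp add: A_def power_mult_distrib)
      then have "real (card (?P r0 r1 Z)) =
          2 ^ (k - 1) * real (card ({1..<k} \<rightarrow>\<^sub>E {\<tau>. \<tau> permutes A \<and> \<tau> ` Z = Z}))"
        by simp
      also have "\<dots> \<le> 2 ^ (k - 1) * (fact (n - 2) ^ (k - 1) / real (n - 2 choose card Z))"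
        by (rule mult_left_mono, rule card_PiE_invariant_le[OF A(1) _ k, of Z, unfolded A(2)])
          (use Z in auto)
      finally have P: "real (card (?P r0 r1 Z)) \<le> 2 ^ (k - 1) * (fact (n - 2) ^ (k - 1) / real (n - 2 choose card Z))" .
      have "real (card (?S r0 Z)) \<le> fact (n - 1) / real (n - 1 choose card Z)"
        using card_permutes_invariant_le[of "?X - {r0}" Z] ZA n1 by auto
      then have "real (card (?S r0 Z \<times> ?P r0 r1 Z))
          \<le> (fact (n - 1) / real (n - 1 choose card Z)) *
             (2 ^ (k - 1) * (fact (n - 2) ^ (k - 1) / real (n - 2 choose card Z)))"
        unfolding card_cartesian_product of_nat_mult by (rule mult_mono[OF _ P]) simp_all
      also have "\<dots> = F (card Z)"
        using Z ZA(2) by (auto simp: F_def C_def Suc_le_eq card_gt_0_iff power_mult_distrib)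
      finally show ?thesis .
    qed
    have "real (card (?W r0 r1)) \<le> real (\<Sum>Z\<in>Pow A - {{}}. card (?S r0 Z \<times> ?P r0 r1 Z))"
      unfolding A_def[symmetric] using A(1) by (intro of_nat_mono card_UN_le) simp
    also have "\<dots> = (\<Sum>Z\<in>Pow A - {{}}. real (card (?S r0 Z \<times> ?P r0 r1 Z)))" by (rule of_nat_sum)
    also have "\<dots> \<le> (\<Sum>Z\<in>Pow A - {{}}. F (card Z))" by (intro sum_mono ZF)
    also have "\<dots> \<le> (\<Sum>Z\<in>Pow A. F (card Z))"
      using A(1) by (intro sum_mono2) (auto simp: F_def C_def)
    also have "\<dots> = (\<Sum>j\<le>n - 2. real (n - 2 choose j) * F j)"
      using sum_Pow_card[OF A(1), of F] A(2) by simp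
    also have "\<dots> = (\<Sum>j = 1..<n - 1. C * (1 / real (n - 1 choose j)))"
      by (rule sum.mono_neutral_cong_right) (use r in \<open>auto simp: F_def\<close>)
    also have "\<dots> = fact (n - 1) * ((2 * fact (n - 2)) ^ (k - 1) * inv_binom_sum (n - 1))"
      unfolding sum_distrib_left[symmetric] by (simp add: C_def inv_binom_sum_def)
    finally show "real (card (?W r0 r1)) \<le> fact (n - 1) * ((2 * fact (n - 2)) ^ (k - 1) * inv_binom_sum (n - 1))" .
  qed
  show ?thesis
    by (rule card_params_le[where W = ?W, OF sub fin card])
qed

definition nonsync_params :: "nat \<Rightarrow> nat \<Rightarrow> (nat \<times> nat \<times> (nat \<Rightarrow> nat) \<times> (nat \<Rightarrow> nat \<Rightarrow> nat)) set" where
  "nonsync_params n k = {t \<in> params n k. strongly_connected {..<n} {..<k} (encode n k t) \<and>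
     \<not> synchronizing {..<n} {..<k} (encode n k t)}"

lemma card_nonsync_params_ge:
  assumes k: "2 \<le> k" and n: "3 \<le> n"
  shows "real (card (moved_params n k)) -
    real n * real (n - 1) * (fact (n - 1) * ((2 * fact (n - 2)) ^ (k - 1) * inv_binom_sum (n - 1)))
    \<le> real (card (nonsync_params n k))"
proof -
  let ?N = "{t \<in> params n k. t \<in> moved_params n k \<and> \<not> strongly_connected {..<n} {..<k} (encode n k t)}"
  have "moved_params n k \<subseteq> nonsync_params n k \<union> ?N"
  proof
    fix t assume t: "t \<in> moved_params n k"
    obtain r0 r1 \<sigma> B where tt: "t = (r0, r1, \<sigma>, B)" by (cases t)
    have tp: "t \<in> params n k" using t moved_params_subset by blast
    interpret almost_group_automaton n k r0 r1 \<sigma> B "encode n k t"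
      using encode_almost_group_automaton[OF k tp[unfolded tt]] unfolding tt .
    have B: "B \<in> {1..<k} \<rightarrow>\<^sub>E pair_stab {..<n} r0 r1"
      using t by (simp add: moved_params_def moved_pair_def tt)
    have "B a ` {r0, r1} = {r0, r1}" if "a \<in> {1..<k}" for a
      using PiE_mem[OF B that] unfolding pair_stab_def by blast
    then have "\<not> synchronizing {..<n} {..<k} (encode n k t)"
      by (rule not_synchronizing_if_pair_invariant[OF n])
    then show "t \<in> nonsync_params n k \<union> ?N" using t tp by (simp add: nonsync_params_def)
  qed
  then have "card (moved_params n k) \<le> card (nonsync_params n k \<union> ?N)"
    using finite_params[of n k] by (intro card_mono) (auto simp: nonsync_params_def)
  also have "\<dots> \<le> card (nonsync_params n k) + card ?N" by (rule card_Un_le)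
  finally have "real (card (moved_params n k)) \<le> real (card (nonsync_params n k)) + real (card ?N)"
    by linarith
  then show ?thesis using card_moved_not_strongly_connected_le[OF k, of n] by linarith
qed

section \<open>Counting by the type of the congruence\<close>

text \<open>The summed stabilizer bound is applied to the restrictions to the states other than
  \<open>r0\<close>. Distinct relations of a type have distinct restrictions, and all these
  restrictions share one profile.\<close>

lemma two_size_rels_sum_rel_stab_le:
  assumes r: "r0 < n" "r1 < n" "r0 \<noteq> r1"
  shows "(\<Sum>R\<in>two_size_rels n r0 r1 s p.
      card (rel_stab ({..<n} - {r0}) (R \<inter> ({..<n} - {r0}) \<times> ({..<n} - {r0})))) \<le> fact (n - 1)"
proof -
  define A where "A = {..<n} - {r0}"
  let ?T = "two_size_rels n r0 r1 s p"
  let ?res = "\<lambda>R. R \<inter> A \<times> A"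
  have A: "finite A" "card A = n - 1" using r by (auto simp: A_def card_Diff_singleton)
  have eq: "equiv {..<n} R" and r01: "(r0, r1) \<in> R" and s: "card (R `` {r0}) = s"
    and p: "class_profile {..<n} R s = p" and sz: "\<And>x. x < n \<Longrightarrow> card (R `` {x}) \<in> {s - 1, s}"
    if "R \<in> ?T" for R
    using that by (auto simp: two_size_rels_def)
  have sub: "R \<subseteq> {..<n} \<times> {..<n}" if "R \<in> ?T" for R using eq[OF that] by (simp add: equiv_def)
  have inj: "inj_on ?res ?T"
  proof -
    \<comment> \<open>As \<open>r0\<close> is equivalent to \<open>r1\<close>, replacing
      \<open>r0\<close> by \<open>r1\<close> in every question about \<open>R\<close> recovers
      \<open>R\<close> from its restriction.\<close>
    define c where "c = (\<lambda>x. if x = r0 then r1 else x)"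
    have "(x, y) \<in> R \<longleftrightarrow> x < n \<and> y < n \<and> (c x, c y) \<in> ?res R" if R: "R \<in> ?T" for R x y
    proof (cases "x < n \<and> y < n")
      case True
      have "R `` {c z} = R `` {z}" for z
        using equiv_class_eq[OF eq[OF R] r01[OF R]] by (simp add: c_def)
      moreover have "c z \<in> A" if "z < n" for z using that r by (auto simp: c_def A_def)
      ultimately show ?thesis
        using True eq_equiv_class_iff[OF eq[OF R], of x y] eq_equiv_class_iff[OF eq[OF R], of "c x" "c y"]
        by (auto simp: A_def)
    next
      case False
      then show ?thesis using sub[OF R] by auto
    qed
    then show ?thesis by (intro inj_onI set_eqI) (metis surj_pair)
  qed
  have prof: "class_profile A (?res R) = class_profile A (?res S)" if RS: "R \<in> ?T" "S \<in> ?T" for R S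
  proof -
    \<comment> \<open>The class of \<open>r0\<close> contributes \<open>s\<close> to
      \<open>p\<close> and drops to size \<open>s - 1\<close>. This leaves \<open>p - s\<close>
      states in classes of size \<open>s\<close> and all others in size \<open>s - 1\<close>,
      whatever \<open>R\<close> is.\<close>
    have "class_profile A (?res R) j = (if j = s then p - s else if j = s - 1 then n - 1 - (p - s) else 0)"
      if R: "R \<in> ?T" for R j
    proof -
      let ?C = "R `` {r0}"
      have finC: "finite ?C" by (rule finite_subset[of _ "{..<n}"]) (use sub[OF R] in auto)
      have r0C: "r0 \<in> ?C" using eq[OF R] r(1) by (intro equiv_class_self) auto
      have s0: "s \<noteq> 0" using r0C by (subst s[OF R, symmetric]) (auto simp: card_eq_0_iff finC)
      have cls: "R `` {x} = ?C" if "x \<in> ?C" for x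
        using equiv_class_eq[OF eq[OF R], of r0 x] that by simp
      have r0cl: "r0 \<in> R `` {x} \<longleftrightarrow> x \<in> ?C" for x
        using eq[OF R] by (auto simp: equiv_def dest: symD)
      have c: "card (?res R `` {x}) = (if x \<in> ?C then s - 1 else card (R `` {x}))" if x: "x \<in> A" for x
      proof -
        have "?res R `` {x} = R `` {x} - {r0}" using x sub[OF R] by (auto simp: A_def)
        then show ?thesis
          using cls[of x] r0cl[of x] s[OF R] r0C finC by (auto simp: card_Diff_singleton)
      qed
      let ?U = "{x \<in> {..<n}. card (R `` {x}) = s} - ?C"
      have Ceq: "?C \<subseteq> {x \<in> {..<n}. card (R `` {x}) = s}"
        using cls s[OF R] sub[OF R] by auto
      have UA: "?U \<subseteq> A" using r0C by (auto simp: A_def)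
      have cU: "card ?U = p - s"
        using Ceq finC s[OF R] p[OF R] by (simp add: card_Diff_subset class_profile_def)
      have "{x \<in> A. card (?res R `` {x}) = j} = (if j = s then ?U else if j = s - 1 then A - ?U else {})"
      proof (intro set_eqI)
        fix x
        show "x \<in> {x \<in> A. card (?res R `` {x}) = j} \<longleftrightarrow>
          x \<in> (if j = s then ?U else if j = s - 1 then A - ?U else {})"
        proof (cases "x \<in> A")
          case True
          then have xn: "x < n" by (simp add: A_def)
          show ?thesis
          proof (cases "x \<in> ?C")
            case C: True
            then have "x \<notin> ?U" by blast
            then show ?thesis using True c[OF True] C s0 by auto
          next
            case C: False
            then have "x \<in> ?U \<longleftrightarrow> card (R `` {x}) = s" using xn by blast
            then show ?thesis using True c[OF True] C s0 sz[OF R xn] by auto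
          qed
        qed (use UA in auto)
      qed
      then show ?thesis
        using cU UA A finite_subset[OF UA A(1)] by (auto simp: class_profile_def card_Diff_subset)
    qed
    from this[OF RS(1)] this[OF RS(2)] show ?thesis by auto
  qed
  have "(\<Sum>R\<in>?T. card (rel_stab A (?res R))) = (\<Sum>R'\<in>?res ` ?T. card (rel_stab A R'))"
    by (simp add: sum.reindex[OF inj])
  also have "\<dots> \<le> fact (card A)"
  proof (rule sum_card_rel_stab_le[OF A(1)])
    show "equiv A R'" if "R' \<in> ?res ` ?T" for R'
      using that eq by (auto simp: A_def intro!: equiv_Int_Times)
    show "class_profile A R' = class_profile A S'" if "R' \<in> ?res ` ?T" "S' \<in> ?res ` ?T" for R' S'
      using that prof by blast
  qed
  finally show ?thesis by (simp add: A_def[symmetric] A(2))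
qed

definition type_params :: "nat \<Rightarrow> nat \<Rightarrow> nat \<Rightarrow> nat \<Rightarrow> (nat \<times> nat \<times> (nat \<Rightarrow> nat) \<times> (nat \<Rightarrow> nat \<Rightarrow> nat)) set" where
  "type_params n k s p = {(r0, r1, \<sigma>, B) \<in> params n k. \<exists>R \<in> two_size_rels n r0 r1 s p.
     (\<forall>a\<in>{1..<k}. B a \<in> rel_stab {..<n} R) \<and>
     \<sigma> \<in> rel_stab ({..<n} - {r0}) (R \<inter> ({..<n} - {r0}) \<times> ({..<n} - {r0}))}"

text \<open>Summing over the relations of the type is charged to \<open>\<sigma>\<close> and yields
  \<open>fact (n - 1)\<close>; each of the other \<open>k - 1\<close> letters contributes the worst
  stabilizer order \<open>M\<close>.\<close>

lemma card_type_params_le: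
  assumes M: "\<And>r0 r1 R. r0 < n \<Longrightarrow> r1 < n \<Longrightarrow> r0 \<noteq> r1 \<Longrightarrow> R \<in> two_size_rels n r0 r1 s p \<Longrightarrow>
      real (card (rel_stab {..<n} R)) \<le> M"
    and M0: "0 \<le> M"
  shows "real (card (type_params n k s p)) \<le> real n * real (n - 1) * (fact (n - 1) * M ^ (k - 1))"
proof -
  let ?S = "\<lambda>r0 R. rel_stab ({..<n} - {r0}) (R \<inter> ({..<n} - {r0}) \<times> ({..<n} - {r0}))"
  let ?P = "\<lambda>R. {1..<k} \<rightarrow>\<^sub>E rel_stab {..<n} R"
  let ?W = "\<lambda>r0 r1. \<Union>R\<in>two_size_rels n r0 r1 s p. ?S r0 R \<times> ?P R"
  have finT: "finite (two_size_rels n r0 r1 s p)" for r0 r1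
    by (rule finite_subset[of _ "Pow ({..<n} \<times> {..<n})"]) (auto simp: two_size_rels_def equiv_def)
  have sub: "(\<sigma>, B) \<in> ?W r0 r1" if t: "(r0, r1, \<sigma>, B) \<in> params n k"
    and P: "(r0, r1, \<sigma>, B) \<in> type_params n k s p" for r0 r1 \<sigma> B
  proof -
    obtain R where "R \<in> two_size_rels n r0 r1 s p" "\<forall>a\<in>{1..<k}. B a \<in> rel_stab {..<n} R" "\<sigma> \<in> ?S r0 R"
      using P by (auto simp: type_params_def)
    then show ?thesis using t by (intro UN_I[of R]) (auto simp: params_def PiE_iff)
  qed
  have fin: "finite (?W r0 r1)"
    and card: "real (card (?W r0 r1)) \<le> fact (n - 1) * M ^ (k - 1)"
    if r: "r0 < n" "r1 < n" "r0 \<noteq> r1" for r0 r1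
  proof -
    have finP: "finite (?P R)" for R by (intro finite_PiE) (auto intro: finite_rel_stab)
    show "finite (?W r0 r1)"
      using finT finP by (intro finite_UN_I finite_SigmaI) (auto intro: finite_rel_stab)
    have "real (card (?W r0 r1)) \<le> real (\<Sum>R\<in>two_size_rels n r0 r1 s p. card (?S r0 R \<times> ?P R))"
      using finT by (intro of_nat_mono card_UN_le)
    also have "\<dots> = (\<Sum>R\<in>two_size_rels n r0 r1 s p. real (card (?S r0 R)) * real (card (rel_stab {..<n} R)) ^ (k - 1))"
      unfolding of_nat_sum card_cartesian_product of_nat_mult card_PiE_const of_nat_power ..
    also have "\<dots> \<le> (\<Sum>R\<in>two_size_rels n r0 r1 s p. real (card (?S r0 R)) * M ^ (k - 1))"
      using M[OF r] by (intro sum_mono mult_left_mono power_mono) auto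
    also have "\<dots> = real (\<Sum>R\<in>two_size_rels n r0 r1 s p. card (?S r0 R)) * M ^ (k - 1)"
      by (simp add: sum_distrib_right)
    also have "\<dots> \<le> real (fact (n - 1)) * M ^ (k - 1)"
      using M0 by (intro mult_right_mono of_nat_mono two_size_rels_sum_rel_stab_le r) auto
    finally show "real (card (?W r0 r1)) \<le> fact (n - 1) * M ^ (k - 1)" by simp
  qed
  have "real (card {t \<in> params n k. t \<in> type_params n k s p}) \<le> real n * real (n - 1) * (fact (n - 1) * M ^ (k - 1))"
    by (rule card_params_le[where W = ?W, OF sub fin card])
  moreover have "{t \<in> params n k. t \<in> type_params n k s p} = type_params n k s p"
    by (auto simp: type_params_def)
  ultimately show ?thesis by simp
qed

text \<open>Representatives are picked greedily: as long as the chosen classes cover fewer points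
  than the profile counts, a new class of size \<open>c\<close> is available.\<close>

lemma obtain_equal_classes:
  assumes X: "finite X" and eq: "equiv X R" and c: "0 < c" and prof: "J * c \<le> class_profile X R c"
  shows "\<exists>E \<subseteq> X. card E = J \<and> card (R `` E) = J * c"
  using prof
proof (induction J)
  case 0
  then show ?case by (intro exI[of _ "{}"]) auto
next
  case (Suc J)
  then obtain E where E: "E \<subseteq> X" "card E = J" "card (R `` E) = J * c" by auto
  have RX: "R \<subseteq> X \<times> X" using eq by (simp add: equiv_def)
  have finR: "finite (R `` E)" for E by (rule finite_subset[OF _ X]) (use RX in auto)
  have "\<not> {x \<in> X. card (R `` {x}) = c} \<subseteq> R `` E"
  proof
    assume "{x \<in> X. card (R `` {x}) = c} \<subseteq> R `` E"
    then have "class_profile X R c \<le> J * c"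
      unfolding class_profile_def E(3)[symmetric] by (rule card_mono[OF finR])
    then show False using Suc.prems c by simp
  qed
  then obtain x where x: "x \<in> X" "card (R `` {x}) = c" "x \<notin> R `` E" by blast
  have xx: "(x, x) \<in> R" using eq x(1) by (auto simp: equiv_def refl_on_def)
  have "x \<notin> E" using x(3) xx by blast
  moreover have "R `` {x} \<inter> R `` E = {}"
    using x(3) eq unfolding equiv_def by (blast dest: symD transD)
  moreover have "R `` insert x E = R `` {x} \<union> R `` E" by blast
  ultimately show ?case
    using E x finite_subset[OF E(1) X] finR
    by (intro exI[of _ "insert x E"]) (simp add: card_Un_disjoint)
qed

text \<open>
  Ruling out \<open>s = 2\<close>, \<open>p < 10\<close>, the relation has either a class with at least \<open>7\<close> elements, or
  five classes of a common size between \<open>2\<close> and \<open>6\<close>.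
\<close>

lemma card_rel_stab_two_size_le:
  assumes r: "r0 < n" "r1 < n" "r0 \<noteq> r1" and R: "R \<in> two_size_rels n r0 r1 s p"
    and n: "60 \<le> n" and sp: "s = 2 \<Longrightarrow> 10 \<le> p"
  shows "real (card (rel_stab {..<n} R)) \<le> real n ^ 5 * (fact 30 * fact (n - 10)) + real n * (fact 6 * fact (n - 6))"
proof -
  let ?X = "{..<n}"
  have eq: "equiv ?X R" and nt: "R \<noteq> ?X \<times> ?X" and r01: "(r0, r1) \<in> R" and s: "card (R `` {r0}) = s"
    and p: "class_profile ?X R s = p" and sz: "\<And>x. x < n \<Longrightarrow> card (R `` {x}) \<in> {s - 1, s}"
    using R by (auto simp: two_size_rels_def)
  have RX: "R \<subseteq> ?X \<times> ?X" using eq by (simp add: equiv_def)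
  have finR: "finite (R `` E)" for E by (rule finite_subset[of _ ?X]) (use RX in auto)
  have r00: "(r0, r0) \<in> R" using eq r(1) by (auto simp: equiv_def refl_on_def)
  have s2: "2 \<le> s"
  proof -
    have "card {r0, r1} \<le> card (R `` {r0})" using r00 r01 by (intro card_mono finR) auto
    then show ?thesis using r(3) s by simp
  qed
  show ?thesis
  proof (cases "7 \<le> s")
    case True
    have "\<exists>x<n. (r0, x) \<notin> R"
    proof (rule ccontr)
      assume "\<not> ?thesis"
      then have all: "\<And>x. x < n \<Longrightarrow> (r0, x) \<in> R" by blast
      have "?X \<times> ?X \<subseteq> R"
      proof (rule subrelI)
        fix x y assume "(x, y) \<in> ?X \<times> ?X"
        then show "(x, y) \<in> R" using all[of x] all[of y] eq unfolding equiv_def by (blast dest: symD transD)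
      qed
      then show False using nt RX by blast
    qed
    then obtain x where x: "x < n" "(r0, x) \<notin> R" by blast
    have "R `` {r0} \<inter> R `` {x} = {}"
      using x(2) eq unfolding equiv_def by (blast dest: symD transD)
    then have "card (R `` {r0}) + card (R `` {x}) = card (R `` {r0} \<union> R `` {x})"
      using finR by (simp add: card_Un_disjoint)
    also have "\<dots> \<le> card ?X" by (rule card_mono) (use RX in auto)
    \<comment> \<open>A class other than that of \<open>r0\<close> exists and has at least
      \<open>s - 1 \<ge> 6\<close> elements.\<close>
    finally have sn: "s + 6 \<le> n" using s sz[OF x(1)] True by auto
    have "card (rel_stab ?X R) \<le> n ^ 1 * (fact s * fact (n - s))"
      using card_rel_stab_le[of ?X R "{r0}"] RX r(1) s by simp
    then have "real (card (rel_stab ?X R)) \<le> real (n ^ 1 * (fact s * fact (n - s)))"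
      by (simp only: of_nat_le_iff)
    moreover have "fact s * fact (n - s) \<le> (fact 6 * fact (n - 6) :: real)"
    proof -
      \<comment> \<open>Unimodality of the binomial coefficients, with \<open>s\<close> between 6
        and \<open>n - 6\<close>.\<close>
      have "n choose 6 \<le> n choose s"
      proof (cases "s \<le> n div 2")
        case True
        then show ?thesis using \<open>7 \<le> s\<close> by (intro binomial_mono) auto
      next
        case False
        then have "n choose (n - 6) \<le> n choose s" using sn by (intro binomial_antimono) auto
        then show ?thesis using n by (simp add: binomial_symmetric[of 6 n])
      qed
      then have "fact n / real (n choose s) \<le> fact n / real (n choose 6)"
        using n sn by (intro divide_left_mono) (auto intro!: mult_pos_pos)
      then show ?thesis using sn n by (simp add: binomial_fact)
    qed
    then have "real n * (fact s * fact (n - s)) \<le> real n * (fact 6 * fact (n - 6))"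
      by (rule mult_left_mono) simp
    ultimately have "real (card (rel_stab ?X R)) \<le> real n * (fact 6 * fact (n - 6))"
      unfolding power_one_right of_nat_mult of_nat_fact by linarith
    moreover have "0 \<le> real n ^ 5 * (fact 30 * fact (n - 10))" by simp
    ultimately show ?thesis by linarith
  next
    case False
    \<comment> \<open>If fewer than \<open>5 * s \<le> 30\<close> states lie in classes of size
      \<open>s\<close>, then at least \<open>n - 29\<close> lie in classes of size
      \<open>s - 1\<close>, enough for five classes. Here \<open>s - 1 \<ge> 2\<close>, because for
      \<open>s = 2\<close> the bound \<open>10 \<le> p\<close> already gives five classes of size
      2.\<close>
    obtain c where c: "2 \<le> c" "c \<le> 6" "5 * c \<le> class_profile ?X R c"
    proof (cases "5 * s \<le> p")
      case True
      then show ?thesis using that[of s] s2 False p by simp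
    next
      case p5: False
      then have "s \<noteq> 2" using sp by auto
      have "?X = {x \<in> ?X. card (R `` {x}) = s} \<union> {x \<in> ?X. card (R `` {x}) = s - 1}"
        using sz by auto
      then have "card ?X \<le> class_profile ?X R s + class_profile ?X R (s - 1)"
        unfolding class_profile_def by (metis (no_types, lifting) card_Un_le)
      then have "5 * (s - 1) \<le> class_profile ?X R (s - 1)" using p5 p n False by simp
      then show ?thesis using that[of "s - 1"] \<open>s \<noteq> 2\<close> s2 False by simp
    qed
    obtain E where E: "E \<subseteq> ?X" "card E = 5" "card (R `` E) = 5 * c"
      using obtain_equal_classes[OF _ eq _ c(3)] c(1) by auto
    have "card (rel_stab ?X R) \<le> n ^ 5 * (fact (5 * c) * fact (n - 5 * c))"
      using card_rel_stab_le[OF _ RX E(1)] E by simp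
    \<comment> \<open>The union of five classes has between 10 and 30 elements.\<close>
    also have "\<dots> \<le> n ^ 5 * (fact 30 * fact (n - 10))"
      using c by (intro mult_left_mono mult_mono fact_mono) auto
    finally have "real (card (rel_stab ?X R)) \<le> real (n ^ 5 * (fact 30 * fact (n - 10)))"
      by (simp only: of_nat_le_iff)
    then have "real (card (rel_stab ?X R)) \<le> real n ^ 5 * (fact 30 * fact (n - 10))"
      by (simp only: of_nat_mult of_nat_power of_nat_fact)
    moreover have "0 \<le> real n * (fact 6 * fact (n - 6))" by simp
    ultimately show ?thesis by linarith
  qed
qed

text \<open>The union of the two-element classes is invariant. With at least three points it costs a
  factor of order \<open>n^(-3)\<close>, against the \<open>n^(-2)\<close> of a single invariant
  pair.\<close>

lemma card_rel_stab_pairs_le: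
  assumes R: "R \<in> two_size_rels n r0 r1 2 p" and p: "3 \<le> p" "p < 10"
  shows "real (card (rel_stab {..<n} R)) \<le> fact 9 * fact (n - 3)"
proof -
  let ?X = "{..<n}"
  have eq: "equiv ?X R" and pr: "class_profile ?X R 2 = p"
    using R by (auto simp: two_size_rels_def)
  have RX: "R \<subseteq> ?X \<times> ?X" using eq by (simp add: equiv_def)
  let ?U = "{x \<in> ?X. card (R `` {x}) = 2}"
  have cU: "card ?U = p" using pr by (simp add: class_profile_def)
  have "rel_stab ?X R \<subseteq> {\<tau>. \<tau> permutes ?X \<and> \<tau> ` ?U = ?U}"
  proof
    fix \<tau> assume \<tau>: "\<tau> \<in> rel_stab ?X R"
    then have perm: "\<tau> permutes ?X" by (simp add: rel_stab_def)
    have "\<tau> ` ?U \<subseteq> ?U"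
    proof (rule image_subsetI)
      fix x assume "x \<in> ?U"
      then show "\<tau> x \<in> ?U"
        using rel_stab_class_card[OF _ RX \<tau>, of x] permutes_in_image[OF perm, of x] by simp
    qed
    then have "\<tau> ` ?U = ?U"
      by (intro endo_inj_surj inj_on_subset[OF permutes_inj[OF perm]]) simp_all
    then show "\<tau> \<in> {\<tau>. \<tau> permutes ?X \<and> \<tau> ` ?U = ?U}" using perm by simp
  qed
  then have "card (rel_stab ?X R) \<le> card {\<tau>. \<tau> permutes ?X \<and> \<tau> ` ?U = ?U}"
    by (intro card_mono finite_subset[OF _ finite_permutations[of ?X]]) auto
  also have "\<dots> \<le> fact p * fact (n - p)"
    using card_permutes_image_le[of ?X ?U ?U, unfolded cU card_lessThan] by blast
  also have "\<dots> \<le> fact 9 * fact (n - 3)"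
    using p by (intro mult_mono fact_mono) auto
  finally have "real (card (rel_stab ?X R)) \<le> real (fact 9 * fact (n - 3))"
    by (simp only: of_nat_le_iff)
  then show ?thesis by (simp only: of_nat_mult of_nat_fact)
qed

text \<open>The class of \<open>r0\<close> already contributes \<open>s\<close> states to
  \<open>p\<close>, so \<open>s = 2\<close> leaves \<open>p = 2\<close>, the range from 3 to 9, and
  \<open>p \<ge> 10\<close>. The case \<open>p = 2\<close> yields the dominant family.\<close>

lemma nonsync_params_subset:
  assumes k: "2 \<le> k"
  shows "nonsync_params n k \<subseteq> moved_params n k \<union>
    (\<Union>p\<in>{3..<10}. type_params n k 2 p) \<union>
    (\<Union>(s, p)\<in>{(s, p). s \<le> n \<and> p \<le> n \<and> (s = 2 \<longrightarrow> 10 \<le> p)}. type_params n k s p)"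
proof
  fix t assume t: "t \<in> nonsync_params n k"
  obtain r0 r1 \<sigma> B where tt: "t = (r0, r1, \<sigma>, B)" by (cases t)
  have tp: "t \<in> params n k" and sc: "strongly_connected {..<n} {..<k} (encode n k t)"
    and ns: "\<not> synchronizing {..<n} {..<k} (encode n k t)"
    using t by (auto simp: nonsync_params_def)
  let ?X = "{..<n}"
  interpret almost_group_automaton n k r0 r1 \<sigma> B "encode n k t"
    using encode_almost_group_automaton[OF k tp[unfolded tt]] unfolding tt .
  obtain s p R where R: "R \<in> two_size_rels n r0 r1 s p" and BR: "\<forall>a\<in>{1..<k}. B a \<in> rel_stab ?X R"
    and \<sigma>R: "\<sigma> \<in> rel_stab (?X - {r0}) (R \<inter> (?X - {r0}) \<times> (?X - {r0}))"
    using nonsync_two_size_rel[OF sc ns] by blast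
  have type: "t \<in> type_params n k s p"
    using tp R BR \<sigma>R unfolding type_params_def tt by blast
  have eq: "equiv ?X R" and r01R: "(r0, r1) \<in> R" and s: "card (R `` {r0}) = s"
    and p: "class_profile ?X R s = p"
    using R by (auto simp: two_size_rels_def)
  have RX: "R \<subseteq> ?X \<times> ?X" using eq by (simp add: equiv_def)
  have finC: "finite (R `` {r0})" by (rule finite_subset[of _ ?X]) (use RX in auto)
  have r00: "(r0, r0) \<in> R" using eq r0 by (auto simp: equiv_def refl_on_def)
  have sn: "s \<le> n" using card_mono[of ?X "R `` {r0}"] RX s by auto
  have pn: "p \<le> n" using card_mono[of ?X "{x \<in> ?X. card (R `` {x}) = s}"] p by (auto simp: class_profile_def)
  have cls: "R `` {x} = R `` {r0}" if "(r0, x) \<in> R" for x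
    using equiv_class_eq[OF eq that] by simp
  have Csub: "R `` {r0} \<subseteq> {x \<in> ?X. card (R `` {x}) = s}"
    using cls s RX by auto
  have sp: "s \<le> p"
    using card_mono[OF _ Csub] s p by (simp add: class_profile_def)
  show "t \<in> moved_params n k \<union> (\<Union>p\<in>{3..<10}. type_params n k 2 p) \<union>
    (\<Union>(s, p)\<in>{(s, p). s \<le> n \<and> p \<le> n \<and> (s = 2 \<longrightarrow> 10 \<le> p)}. type_params n k s p)"
  proof (cases "s = 2 \<and> p < 10")
    case False
    then have "(s, p) \<in> {(s, p). s \<le> n \<and> p \<le> n \<and> (s = 2 \<longrightarrow> 10 \<le> p)}" using sn pn by auto
    then show ?thesis using type by (intro UnI2 UN_I[of "(s, p)"]) auto
  next
    case sp10: True
    show ?thesis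
    proof (cases "p = 2")
      case False
      then show ?thesis using type sp10 sp by auto
    next
      case True
      have D: "{r0, r1} = R `` {r0}"
        using r00 r01R finC s sp10 r01 by (intro card_subset_eq) auto
      \<comment> \<open>Since \<open>p = 2\<close>, the pair is the only class of its size, so every
        permutation stabilizing \<open>R\<close> preserves it.\<close>
      have U: "{r0, r1} = {x \<in> ?X. card (R `` {x}) = s}"
        unfolding D using Csub s p sp10 True by (intro card_subset_eq) (auto simp: class_profile_def)
      have ps: "B a \<in> pair_stab ?X r0 r1" if a: "a \<in> {1..<k}" for a
      proof -
        have st: "B a \<in> rel_stab ?X R" using BR a by blast
        have "B a x \<in> {r0, r1}" if "x \<in> {r0, r1}" for x
          using that rel_stab_class_card[OF _ RX st, of x] B_in[OF a, of x] unfolding U by simp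
        then have "B a ` {r0, r1} \<subseteq> {r0, r1}" by blast
        then have "B a ` {r0, r1} = {r0, r1}"
          by (intro endo_inj_surj inj_on_subset[OF permutes_inj[OF B[OF a]]]) simp_all
        then show ?thesis using B[OF a] by (simp add: pair_stab_def)
      qed
      obtain a where a: "a \<in> {1..<k}" "B a r0 \<noteq> r0"
        using strongly_connected_moves_r0[OF sc] by blast
      have "B a \<notin> {\<tau>. \<tau> permutes ?X - {r0, r1}}"
        using a(2) by (auto dest: permutes_not_in[of _ _ r0])
      then have "B \<notin> {1..<k} \<rightarrow>\<^sub>E {\<tau>. \<tau> permutes ?X - {r0, r1}}"
        using a(1) PiE_mem by blast
      moreover have "B \<in> {1..<k} \<rightarrow>\<^sub>E pair_stab ?X r0 r1"
        using tp ps by (auto simp: params_def tt PiE_iff)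
      ultimately have "t \<in> moved_params n k"
        using tp by (simp add: moved_params_def params_def tt moved_pair_def)
      then show ?thesis by simp
    qed
  qed
qed

text \<open>The factor 7 counts the values of \<open>p\<close> from 3 to 9 for \<open>s = 2\<close>,
  and \<open>(n + 1)^2\<close> bounds the number of remaining types.\<close>

lemma card_nonsync_params_le:
  assumes k: "2 \<le> k" and n: "60 \<le> n"
  shows "real (card (nonsync_params n k)) \<le> real (card (moved_params n k)) +
    real n * real (n - 1) * (fact (n - 1) *
      (7 * (fact 9 * fact (n - 3)) ^ (k - 1) + (real n + 1)\<^sup>2 *
        (real n ^ 5 * (fact 30 * fact (n - 10)) + real n * (fact 6 * fact (n - 6))) ^ (k - 1)))"
proof -
  let ?I = "{(s, p). s \<le> n \<and> p \<le> n \<and> (s = 2 \<longrightarrow> 10 \<le> p)}"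
  define N where "N = real n * real (n - 1)"
  define M2 :: real where "M2 = fact 9 * fact (n - 3)"
  define M where "M = real n ^ 5 * (fact 30 * fact (n - 10)) + real n * (fact 6 * fact (n - 6))"
  have I: "?I \<subseteq> {..n} \<times> {..n}" by auto
  then have finI: "finite ?I" by (rule finite_subset) simp
  have fin: "finite (type_params n k s p)" for s p
    by (rule finite_subset[OF _ finite_params[of n k]]) (auto simp: type_params_def)
  have finm: "finite (moved_params n k)" using moved_params_subset finite_params finite_subset by blast
  let ?A = "\<Union>p\<in>{3..<10}. type_params n k 2 p" and ?B = "\<Union>(s, p)\<in>?I. type_params n k s p"
  have "card (nonsync_params n k) \<le> card (moved_params n k \<union> ?A \<union> ?B)"
    using fin finI finm by (intro card_mono nonsync_params_subset[OF k]) auto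
  also have "\<dots> \<le> card (moved_params n k) + card ?A + card ?B"
    by (meson card_Un_le le_trans add_right_mono)
  finally have "real (card (nonsync_params n k)) \<le> real (card (moved_params n k)) + real (card ?A) + real (card ?B)"
    by linarith
  moreover have "real (card ?A) \<le> N * (fact (n - 1) * (7 * M2 ^ (k - 1)))"
  proof -
    have "real (card ?A) \<le> real (\<Sum>p\<in>{3..<10}. card (type_params n k 2 p))"
      by (intro of_nat_mono card_UN_le) simp
    also have "\<dots> = (\<Sum>p\<in>{3..<10::nat}. real (card (type_params n k 2 p)))" by simp
    also have "\<dots> \<le> (\<Sum>p\<in>{3..<10::nat}. N * (fact (n - 1) * M2 ^ (k - 1)))"
      unfolding N_def M2_def by (intro sum_mono card_type_params_le card_rel_stab_pairs_le) auto
    finally show ?thesis by simp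
  qed
  moreover have "real (card ?B) \<le> N * (fact (n - 1) * ((real n + 1)\<^sup>2 * M ^ (k - 1)))"
  proof -
    have "real (card ?B) \<le> real (\<Sum>i\<in>?I. card (case i of (s, p) \<Rightarrow> type_params n k s p))"
      by (intro of_nat_mono card_UN_le finI)
    also have "\<dots> = (\<Sum>i\<in>?I. real (card (case i of (s, p) \<Rightarrow> type_params n k s p)))" by simp
    also have "\<dots> \<le> (\<Sum>i\<in>?I. N * (fact (n - 1) * M ^ (k - 1)))"
    proof (rule sum_mono)
      fix i assume i: "i \<in> ?I"
      obtain s p where sp: "i = (s, p)" by (cases i)
      have "real (card (type_params n k s p)) \<le> N * (fact (n - 1) * M ^ (k - 1))"
        unfolding N_def M_def
        by (intro card_type_params_le card_rel_stab_two_size_le) (use n i sp in auto)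
      then show "real (card (case i of (s, p) \<Rightarrow> type_params n k s p)) \<le> N * (fact (n - 1) * M ^ (k - 1))"
        by (simp add: sp)
    qed
    also have "\<dots> = real (card ?I) * (N * (fact (n - 1) * M ^ (k - 1)))" by simp
    also have "\<dots> \<le> (real n + 1)\<^sup>2 * (N * (fact (n - 1) * M ^ (k - 1)))"
    proof (rule mult_right_mono)
      have "card ?I \<le> card ({..n} \<times> {..n})" by (rule card_mono[OF _ I]) simp
      then have "real (card ?I) \<le> real ((n + 1) * (n + 1))"
        unfolding of_nat_le_iff by (simp add: card_cartesian_product)
      then show "real (card ?I) \<le> (real n + 1)\<^sup>2" by (simp add: power2_eq_square algebra_simps)
      show "0 \<le> N * (fact (n - 1) * M ^ (k - 1))" by (simp add: N_def M_def)
    qed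
    finally show ?thesis by (simp add: mult_ac)
  qed
  ultimately show ?thesis unfolding N_def M_def M2_def by (simp add: algebra_simps)
qed

section \<open>Asymptotics\<close>

lemma fact_power_le: "fact m * Suc m ^ j \<le> (fact (m + j) :: nat)"
proof (induction j)
  case (Suc j)
  have "fact m * Suc m ^ Suc j = (fact m * Suc m ^ j) * Suc m" by (simp only: power_Suc mult_ac)
  also have "\<dots> \<le> fact (m + j) * (m + Suc j)" by (intro mult_mono Suc.IH) auto
  also have "\<dots> = fact (m + Suc j)" by simp
  finally show ?case .
qed simp

text \<open>The quotient \<open>n! / (n - j)!\<close> is a product of \<open>j\<close> factors, each
  at least \<open>n / 2\<close>. This replaces factorials by powers in the error terms.\<close>

lemma fact_diff_divide_le:
  assumes "j \<le> n" "2 * j \<le> n" "0 < n"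
  shows "fact (n - j) / fact n \<le> (2 / real n) ^ j"
proof -
  have "real (fact (n - j) * Suc (n - j) ^ j) \<le> real (fact n)"
    using fact_power_le[of "n - j" j] assms(1) by (simp only: of_nat_le_iff le_add_diff_inverse2)
  then have "fact (n - j) * real (Suc (n - j)) ^ j \<le> fact n"
    by (simp only: of_nat_mult of_nat_power of_nat_fact)
  moreover have "fact (n - j) * (real n / 2) ^ j \<le> fact (n - j) * real (Suc (n - j)) ^ j"
    using assms by (intro mult_left_mono power_mono) (auto simp: of_nat_diff)
  ultimately have "fact (n - j) * (real n / 2) ^ j \<le> fact n" by linarith
  then show ?thesis using assms(3) by (simp add: field_simps power_divide)
qed

text \<open>Only \<open>j = 1\<close> and \<open>j = n - 1\<close> give terms of order
  \<open>1 / n\<close>. All other binomials are at least \<open>n choose 2\<close>, so fewer than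
  \<open>n\<close> terms of order \<open>1 / n^2\<close> remain.\<close>

lemma inv_binom_sum_le:
  assumes n: "4 \<le> n"
  shows "inv_binom_sum n \<le> 4 / real n + 4 / real n"
proof -
  have "inv_binom_sum n \<le> (\<Sum>j = 1..<n. (if j = 1 \<or> j = n - 1 then 1 / real n else 0) + 4 / (real n)\<^sup>2)"
    unfolding inv_binom_sum_def
  proof (rule sum_mono)
    fix j assume j: "j \<in> {1..<n}"
    show "1 / real (n choose j) \<le> (if j = 1 \<or> j = n - 1 then 1 / real n else 0) + 4 / (real n)\<^sup>2"
    proof (cases "j = 1 \<or> j = n - 1")
      case True
      then have "n choose j = n" using n binomial_symmetric[of 1 n] by auto
      then show ?thesis using True by simp
    next
      case False
      have "n choose 2 \<le> n choose j"
      proof (cases "j \<le> n div 2")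
        case True
        then show ?thesis using False j by (intro binomial_mono) auto
      next
        case jn: False
        then have "n choose (n - 2) \<le> n choose j" using n j False by (intro binomial_antimono) auto
        then show ?thesis using n by (simp add: binomial_symmetric[of 2 n])
      qed
      moreover have "(real n)\<^sup>2 / 4 \<le> real (n choose 2)"
      proof -
        have "real (n choose 2) = real n * (real n - 1) / 2"
          using n by (simp add: choose_two real_of_nat_div of_nat_diff)
        moreover have "4 * real n \<le> real n * real n" using n by (intro mult_right_mono) auto
        ultimately show ?thesis by (simp add: power2_eq_square field_simps)
      qed
      ultimately have "(real n)\<^sup>2 / 4 \<le> real (n choose j)" by linarith
      then have "1 / real (n choose j) \<le> 1 / ((real n)\<^sup>2 / 4)"
        using n j by (intro divide_left_mono) (auto intro!: mult_pos_pos simp: zero_less_binomial_iff)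
      then show ?thesis using False by simp
    qed
  qed
  also have "\<dots> = 2 / real n + real (n - 1) * (4 / (real n)\<^sup>2)"
  proof -
    have "(\<Sum>j = 1..<n. if j = 1 \<or> j = n - 1 then 1 / real n else 0) = (\<Sum>j\<in>{1, n - 1}. 1 / real n)"
      by (rule sum.mono_neutral_cong_right) (use n in auto)
    also have "\<dots> = 2 / real n" using n by simp
    finally show ?thesis by (simp add: sum.distrib)
  qed
  also have "\<dots> \<le> 4 / real n + 4 / real n"
  proof -
    have "real (n - 1) * (4 / (real n)\<^sup>2) \<le> real n * (4 / (real n)\<^sup>2)" by (intro mult_right_mono) auto
    also have "\<dots> = 4 / real n" using n by (simp add: power2_eq_square)
    finally have "real (n - 1) * (4 / (real n)\<^sup>2) \<le> 4 / real n" .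
    moreover have "2 / real n \<le> 4 / real n" by (rule divide_right_mono) auto
    ultimately show ?thesis by linarith
  qed
  finally show ?thesis .
qed

lemma inv_binom_sum_nonneg: "0 \<le> inv_binom_sum n"
  unfolding inv_binom_sum_def by (intro sum_nonneg) auto

lemma inv_binom_sum_tendsto: "inv_binom_sum \<longlonglongrightarrow> 0"
proof (rule tendsto_sandwich[of "\<lambda>_. 0" _ _ "\<lambda>n. 4 / real n + 4 / real n"])
  show "\<forall>\<^sub>F n in sequentially. inv_binom_sum n \<le> 4 / real n + 4 / real n"
    using eventually_ge_at_top[of 4] by eventually_elim (rule inv_binom_sum_le)
  show "(\<lambda>n. 4 / real n + 4 / real n) \<longlonglongrightarrow> 0" by real_asymp
qed (auto intro: inv_binom_sum_nonneg always_eventually)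

lemma params_pos: "2 \<le> n \<Longrightarrow> 0 < real (card (params n k))"
  by (simp add: card_params)

lemma card_params_real:
  "real (card (params n k)) = real n * real (n - 1) * (fact (n - 1) * fact n ^ (k - 1))"
  by (simp add: card_params)

section \<open>Limits of the normalized counts\<close>

definition sc_params :: "nat \<Rightarrow> nat \<Rightarrow> (nat \<times> nat \<times> (nat \<Rightarrow> nat) \<times> (nat \<Rightarrow> nat \<Rightarrow> nat)) set" where
  "sc_params n k = {t \<in> params n k. strongly_connected {..<n} {..<k} (encode n k t)}"

lemma sc_ratio_tendsto:
  assumes k: "2 \<le> k"
  shows "(\<lambda>n. real (card (sc_params n k)) / real (card (params n k))) \<longlonglongrightarrow> 1"
proof (rule tendsto_sandwich[of "\<lambda>n. 1 - 2 * inv_binom_sum n" _ _ "\<lambda>_. 1"])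
  show "\<forall>\<^sub>F n in sequentially. 1 - 2 * inv_binom_sum n \<le> real (card (sc_params n k)) / real (card (params n k))"
    using eventually_ge_at_top[of 2]
  proof eventually_elim
    case (elim n)
    let ?N = "{t \<in> params n k. \<not> strongly_connected {..<n} {..<k} (encode n k t)}"
    have "card (params n k) \<le> card (sc_params n k \<union> ?N)"
      using finite_params[of n k] by (intro card_mono) (auto simp: sc_params_def)
    also have "\<dots> \<le> card (sc_params n k) + card ?N" by (rule card_Un_le)
    finally have "real (card (params n k)) - real (card ?N) \<le> real (card (sc_params n k))" by linarith
    moreover have "real (card ?N) \<le> real (card (params n k)) * (2 * inv_binom_sum n)"
      using card_not_strongly_connected_le[OF k, of n] unfolding card_params_real by (simp add: mult_ac)
    ultimately have "real (card (params n k)) * (1 - 2 * inv_binom_sum n) \<le> real (card (sc_params n k))"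
      by (simp add: algebra_simps)
    then show ?case using params_pos[OF elim, of k] by (simp add: field_simps)
  qed
  show "\<forall>\<^sub>F n in sequentially. real (card (sc_params n k)) / real (card (params n k)) \<le> 1"
  proof (rule always_eventually, rule allI)
    fix n
    have "card (sc_params n k) \<le> card (params n k)"
      using finite_params[of n k] by (intro card_mono) (auto simp: sc_params_def)
    then show "real (card (sc_params n k)) / real (card (params n k)) \<le> 1" by (simp add: divide_le_eq)
  qed
  have "(\<lambda>n. 1 - 2 * inv_binom_sum n) \<longlonglongrightarrow> 1 - 2 * 0"
    by (intro tendsto_intros inv_binom_sum_tendsto)
  then show "(\<lambda>n. 1 - 2 * inv_binom_sum n) \<longlonglongrightarrow> 1" by simp
qed auto

text \<open>The factor \<open>n (n - 1) (n - 1)!\<close> is common to all counts and cancels. The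
  power \<open>n^(2 (k - 1))\<close> is shared out as \<open>n^2\<close> per permutation letter, so
  the contributions become \<open>m\<close>-th powers of \<open>c\<close>, which tends to 1, of
  \<open>d\<close>, of order at most \<open>1 / n\<close>, and of \<open>e\<close>, of order at most
  \<open>n^(-3)\<close>.\<close>

lemma nonsync_ratio_tendsto:
  assumes k: "2 \<le> k"
  shows "(\<lambda>n. real (card (nonsync_params n k)) / real (card (params n k)) * real n ^ (2 * (k - 1)))
    \<longlonglongrightarrow> 2 ^ (k - 1) - 1"
proof -
  define m where "m = k - 1"
  have m: "1 \<le> m" using k by (simp add: m_def)
  define L :: real where "L = 2 ^ m - 1"
  define c where "c = (\<lambda>n. (real n)\<^sup>2 * (fact (n - 2) / fact n))"
  define d where "d = (\<lambda>n. (real n)\<^sup>2 * (fact 9 * fact (n - 3) / fact n))"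
  define e where "e = (\<lambda>n. (real n)\<^sup>2 *
    ((real n ^ 5 * (fact 30 * fact (n - 10)) + real n * (fact 6 * fact (n - 6))) / fact n))"
  have c: "c \<longlonglongrightarrow> 1"
  proof (rule Lim_transform_eventually)
    show "(\<lambda>n. (real n)\<^sup>2 * (1 / (real n * (real n - 1)))) \<longlonglongrightarrow> 1" by real_asymp
    show "\<forall>\<^sub>F n in sequentially. (real n)\<^sup>2 * (1 / (real n * (real n - 1))) = c n"
      using eventually_ge_at_top[of 2]
    proof eventually_elim
      case (elim n)
      then obtain i where i: "n = Suc (Suc i)" by (metis add_2_eq_Suc le_Suc_ex)
      show ?case by (simp add: c_def i)
    qed
  qed
  have d0: "0 \<le> d n" for n by (simp add: d_def)
  have e0: "0 \<le> e n" for n by (simp add: e_def)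
  have d: "d \<longlonglongrightarrow> 0"
  proof (rule tendsto_sandwich[of "\<lambda>_. 0" _ _ "\<lambda>n. (real n)\<^sup>2 * (fact 9 * (2 / real n) ^ 3)"])
    show "\<forall>\<^sub>F n in sequentially. d n \<le> (real n)\<^sup>2 * (fact 9 * (2 / real n) ^ 3)"
      using eventually_ge_at_top[of 60]
    proof eventually_elim
      case (elim n)
      have "fact 9 * (fact (n - 3) / fact n) \<le> fact 9 * (2 / real n) ^ 3"
        using elim by (intro mult_left_mono fact_diff_divide_le) auto
      then show ?case unfolding d_def by (intro mult_left_mono) auto
    qed
    show "(\<lambda>n. (real n)\<^sup>2 * (fact 9 * (2 / real n) ^ 3)) \<longlonglongrightarrow> 0" by real_asymp
  qed (use d0 in auto)
  have ebound: "\<forall>\<^sub>F n in sequentially. e n \<le> (real n)\<^sup>2 *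
      (real n ^ 5 * (fact 30 * (2 / real n) ^ 10) + real n * (fact 6 * (2 / real n) ^ 6))"
    using eventually_ge_at_top[of 60]
  proof eventually_elim
    case (elim n)
    have "real n ^ 5 * (fact 30 * (fact (n - 10) / fact n)) \<le> real n ^ 5 * (fact 30 * (2 / real n) ^ 10)"
      using elim by (intro mult_left_mono fact_diff_divide_le) auto
    moreover have "real n * (fact 6 * (fact (n - 6) / fact n)) \<le> real n * (fact 6 * (2 / real n) ^ 6)"
      using elim by (intro mult_left_mono fact_diff_divide_le) auto
    ultimately have "real n ^ 5 * (fact 30 * (fact (n - 10) / fact n)) + real n * (fact 6 * (fact (n - 6) / fact n))
        \<le> real n ^ 5 * (fact 30 * (2 / real n) ^ 10) + real n * (fact 6 * (2 / real n) ^ 6)"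
      by (rule add_mono)
    then show ?case unfolding e_def by (intro mult_left_mono) (simp_all add: add_divide_distrib)
  qed
  have e: "(\<lambda>n. (real n + 1)\<^sup>2 * e n) \<longlonglongrightarrow> 0"
  proof (rule tendsto_sandwich[of "\<lambda>_. 0" _ _ "\<lambda>n. (real n + 1)\<^sup>2 * ((real n)\<^sup>2 *
      (real n ^ 5 * (fact 30 * (2 / real n) ^ 10) + real n * (fact 6 * (2 / real n) ^ 6)))"])
    show "\<forall>\<^sub>F n in sequentially. (real n + 1)\<^sup>2 * e n \<le> (real n + 1)\<^sup>2 * ((real n)\<^sup>2 *
      (real n ^ 5 * (fact 30 * (2 / real n) ^ 10) + real n * (fact 6 * (2 / real n) ^ 6)))"
      using ebound by eventually_elim (intro mult_left_mono, auto)
    show "(\<lambda>n. (real n + 1)\<^sup>2 * ((real n)\<^sup>2 *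
      (real n ^ 5 * (fact 30 * (2 / real n) ^ 10) + real n * (fact 6 * (2 / real n) ^ 6)))) \<longlonglongrightarrow> 0"
      by real_asymp
  qed (use e0 in auto)
  \<comment> \<open>Once \<open>e n \<le> 1\<close>, powers only decrease it, which reduces the
    claim to the critical exponent \<open>m = 1\<close>.\<close>
  have em: "(\<lambda>n. (real n + 1)\<^sup>2 * e n ^ m) \<longlonglongrightarrow> 0"
  proof (rule tendsto_sandwich[of "\<lambda>_. 0" _ _ "\<lambda>n. (real n + 1)\<^sup>2 * e n"])
    have "\<forall>\<^sub>F n in sequentially. (real n + 1)\<^sup>2 * e n < 1"
      using e by (rule order_tendstoD) simp
    then show "\<forall>\<^sub>F n in sequentially. (real n + 1)\<^sup>2 * e n ^ m \<le> (real n + 1)\<^sup>2 * e n"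
    proof eventually_elim
      case (elim n)
      have "1 * e n \<le> (real n + 1)\<^sup>2 * e n" by (intro mult_right_mono e0 one_le_power) simp
      then have "e n \<le> 1" using elim by linarith
      then have "e n ^ m \<le> e n ^ 1" using m e0 by (intro power_decreasing) auto
      then show ?case by (intro mult_left_mono) auto
    qed
  qed (use e0 e in auto)
  let ?q = "\<lambda>n. real (card (nonsync_params n k)) / real (card (params n k)) * real n ^ (2 * m)"
  have frac: "x / fact n ^ m * real n ^ (2 * m) = ((real n)\<^sup>2 * (y / fact n)) ^ m" if "x = y ^ m" for x y :: real and n
    unfolding that by (simp add: power_mult power_mult_distrib power_divide)
  have cm: "fact (n - 2) ^ m / fact n ^ m * real n ^ (2 * m) = c n ^ m" for n
    unfolding c_def by (rule frac) simp
  have dm: "(fact 9 * fact (n - 3)) ^ m / fact n ^ m * real n ^ (2 * m) = d n ^ m" for n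
    unfolding d_def by (rule frac) simp
  have emm: "(real n ^ 5 * (fact 30 * fact (n - 10)) + real n * (fact 6 * fact (n - 6))) ^ m / fact n ^ m * real n ^ (2 * m)
      = e n ^ m" for n
    unfolding e_def by (rule frac) simp
  have cancel: "real n * real (n - 1) * (fact (n - 1) * z) / real (card (params n k)) = z / fact n ^ m" if "2 \<le> n" for n z
    using that unfolding card_params_real m_def by simp
  have upper: "\<forall>\<^sub>F n in sequentially. ?q n \<le> L * c n ^ m + (7 * d n ^ m + (real n + 1)\<^sup>2 * e n ^ m)"
    using eventually_ge_at_top[of 60]
  proof eventually_elim
    case (elim n)
    define z where "z = L * fact (n - 2) ^ m + (7 * (fact 9 * fact (n - 3)) ^ m + (real n + 1)\<^sup>2 *
        (real n ^ 5 * (fact 30 * fact (n - 10)) + real n * (fact 6 * fact (n - 6))) ^ m)"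
    have "real (card (nonsync_params n k)) \<le> real n * real (n - 1) * (fact (n - 1) * z)"
      using card_nonsync_params_le[OF k elim] unfolding card_moved_params z_def L_def m_def[symmetric]
      by (simp only: distrib_left)
    then have "real (card (nonsync_params n k)) / real (card (params n k)) \<le>
        real n * real (n - 1) * (fact (n - 1) * z) / real (card (params n k))"
      by (rule divide_right_mono) simp
    also have "\<dots> = z / fact n ^ m" using elim by (intro cancel) simp
    finally have "real (card (nonsync_params n k)) / real (card (params n k)) \<le> z / fact n ^ m" .
    then have "?q n \<le> z / fact n ^ m * real n ^ (2 * m)" by (intro mult_right_mono) auto
    also have "\<dots> = L * (fact (n - 2) ^ m / fact n ^ m * real n ^ (2 * m)) +
      (7 * ((fact 9 * fact (n - 3)) ^ m / fact n ^ m * real n ^ (2 * m)) + (real n + 1)\<^sup>2 *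
        ((real n ^ 5 * (fact 30 * fact (n - 10)) + real n * (fact 6 * fact (n - 6))) ^ m / fact n ^ m * real n ^ (2 * m)))"
      unfolding z_def by (simp only: add_divide_distrib distrib_right times_divide_eq_right[symmetric] mult.assoc)
    finally show ?case unfolding cm dm emm .
  qed
  have lower: "\<forall>\<^sub>F n in sequentially. L * c n ^ m - 2 ^ m * c n ^ m * inv_binom_sum (n - 1) \<le> ?q n"
    using eventually_ge_at_top[of 3]
  proof eventually_elim
    case (elim n)
    define z where "z = L * fact (n - 2) ^ m - (2 * fact (n - 2)) ^ m * inv_binom_sum (n - 1)"
    have "real n * real (n - 1) * (fact (n - 1) * z) \<le> real (card (nonsync_params n k))"
      using card_nonsync_params_ge[OF k elim] unfolding card_moved_params z_def L_def m_def[symmetric]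
      by (simp only: right_diff_distrib)
    then have "real n * real (n - 1) * (fact (n - 1) * z) / real (card (params n k)) \<le>
        real (card (nonsync_params n k)) / real (card (params n k))"
      by (rule divide_right_mono) simp
    moreover have "real n * real (n - 1) * (fact (n - 1) * z) / real (card (params n k)) = z / fact n ^ m"
      using elim by (intro cancel) simp
    ultimately have "z / fact n ^ m \<le> real (card (nonsync_params n k)) / real (card (params n k))" by simp
    then have "z / fact n ^ m * real n ^ (2 * m) \<le> ?q n" by (intro mult_right_mono) auto
    moreover have "z / fact n ^ m * real n ^ (2 * m) = L * (fact (n - 2) ^ m / fact n ^ m * real n ^ (2 * m)) -
        2 ^ m * (fact (n - 2) ^ m / fact n ^ m * real n ^ (2 * m)) * inv_binom_sum (n - 1)"
      unfolding z_def power_mult_distrib by (simp add: diff_divide_distrib algebra_simps)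
    ultimately show ?case unfolding cm by simp
  qed
  have "?q \<longlonglongrightarrow> L"
  proof (rule tendsto_sandwich[OF lower upper])
    have "(\<lambda>n. inv_binom_sum (n - 1)) \<longlonglongrightarrow> 0"
      by (rule filterlim_compose[OF inv_binom_sum_tendsto]) real_asymp
    then have "(\<lambda>n. L * c n ^ m - 2 ^ m * c n ^ m * inv_binom_sum (n - 1)) \<longlonglongrightarrow> L * 1 ^ m - 2 ^ m * 1 ^ m * 0"
      by (intro tendsto_intros c)
    then show "(\<lambda>n. L * c n ^ m - 2 ^ m * c n ^ m * inv_binom_sum (n - 1)) \<longlonglongrightarrow> L" by simp
    have "(\<lambda>n. L * c n ^ m + (7 * d n ^ m + (real n + 1)\<^sup>2 * e n ^ m)) \<longlonglongrightarrow> L * 1 ^ m + (7 * 0 ^ m + 0)"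
      by (intro tendsto_intros c d em)
    then show "(\<lambda>n. L * c n ^ m + (7 * d n ^ m + (real n + 1)\<^sup>2 * e n ^ m)) \<longlonglongrightarrow> L"
      using m by (simp add: zero_power)
  qed
  then show ?thesis by (simp add: m_def L_def)
qed

lemma prob_nonsync:
  assumes "2 \<le> k" "2 \<le> n"
  shows "measure_pmf.prob (pmf_of_set (sc_almost_group_automata n k)) {\<delta>. \<not> synchronizing {..<n} {..<k} \<delta>}
    = real (card (nonsync_params n k)) / real (card (sc_params n k))"
proof -
  have "sc_almost_group_automata n k \<inter> {\<delta>. \<not> synchronizing {..<n} {..<k} \<delta>} =
    {\<delta> \<in> almost_group_automata n k. strongly_connected {..<n} {..<k} \<delta> \<and> \<not> synchronizing {..<n} {..<k} \<delta>}"
    by (auto simp: sc_almost_group_automata_def)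
  then have "card (sc_almost_group_automata n k \<inter> {\<delta>. \<not> synchronizing {..<n} {..<k} \<delta>}) = card (nonsync_params n k)"
    by (simp only: card_almost_group_automata_Collect[OF assms(1)] nonsync_params_def)
  moreover have "card (sc_almost_group_automata n k) = card (sc_params n k)"
    unfolding sc_almost_group_automata_def sc_params_def by (rule card_almost_group_automata_Collect[OF assms(1)])
  ultimately show ?thesis
    using measure_pmf_of_set[OF sc_almost_group_automata_nonempty[OF assms(2,1)] finite_sc_almost_group_automata]
    by simp
qed

theorem theorem2:
  fixes k :: nat
  assumes "k \<ge> 2"
  shows "((\<lambda>n. measure_pmf.prob (pmf_of_set (sc_almost_group_automata n k))
                  {\<delta>. \<not> synchronizing {..<n} {..<k} \<delta>})
            \<sim>[at_top] (\<lambda>n. (2 ^ (k - 1) - 1) * real n powi (- 2 * (int k - 1))))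
       \<and> (\<lambda>n. measure_pmf.prob (pmf_of_set (sc_almost_group_automata n k))
                  {\<delta>. synchronizing {..<n} {..<k} \<delta>}) \<longlonglongrightarrow> 1"
proof -
  let ?P = "\<lambda>n. measure_pmf.prob (pmf_of_set (sc_almost_group_automata n k)) {\<delta>. \<not> synchronizing {..<n} {..<k} \<delta>}"
  define L :: real where "L = 2 ^ (k - 1) - 1"
  \<comment> \<open>The constant is positive because \<open>k \<ge> 2\<close>; the asymptotic
    equivalence divides by it.\<close>
  have "(2::real) ^ 1 \<le> 2 ^ (k - 1)" using assms by (intro power_increasing) auto
  then have L: "L > 0" by (simp add: L_def)
  have powi: "real n powi (- 2 * (int k - 1)) = 1 / real n ^ (2 * (k - 1))" for n
  proof -
    have "- 2 * (int k - 1) = - int (2 * (k - 1))" using assms by (simp add: of_nat_diff)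
    then show ?thesis by (simp only: power_int_minus power_int_of_nat inverse_eq_divide)
  qed
  \<comment> \<open>Conditioning on strong connectivity divides the proportion among all parameters
    by a proportion that tends to 1.\<close>
  have lim: "(\<lambda>n. ?P n * real n ^ (2 * (k - 1))) \<longlonglongrightarrow> L"
  proof (rule Lim_transform_eventually)
    have "(\<lambda>n. (real (card (nonsync_params n k)) / real (card (params n k)) * real n ^ (2 * (k - 1))) /
        (real (card (sc_params n k)) / real (card (params n k)))) \<longlonglongrightarrow> L / 1"
      unfolding L_def by (intro tendsto_divide nonsync_ratio_tendsto sc_ratio_tendsto assms) simp
    then show "(\<lambda>n. (real (card (nonsync_params n k)) / real (card (params n k)) * real n ^ (2 * (k - 1))) /
        (real (card (sc_params n k)) / real (card (params n k)))) \<longlonglongrightarrow> L" by simp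
    show "\<forall>\<^sub>F n in sequentially. (real (card (nonsync_params n k)) / real (card (params n k)) * real n ^ (2 * (k - 1))) /
        (real (card (sc_params n k)) / real (card (params n k))) = ?P n * real n ^ (2 * (k - 1))"
      using eventually_ge_at_top[of 2]
    proof eventually_elim
      case (elim n)
      show ?case using params_pos[OF elim, of k] unfolding prob_nonsync[OF assms elim] by simp
    qed
  qed
  have "?P \<sim>[at_top] (\<lambda>n. L * real n powi (- 2 * (int k - 1)))"
  proof (rule asymp_equivI')
    show "(\<lambda>n. ?P n / (L * real n powi (- 2 * (int k - 1)))) \<longlonglongrightarrow> 1"
    proof (rule Lim_transform_eventually)
      show "(\<lambda>n. ?P n * real n ^ (2 * (k - 1)) / L) \<longlonglongrightarrow> 1"
        using tendsto_divide[OF lim tendsto_const[of L]] L by simp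
      show "\<forall>\<^sub>F n in sequentially. ?P n * real n ^ (2 * (k - 1)) / L = ?P n / (L * real n powi (- 2 * (int k - 1)))"
        unfolding powi by simp
    qed
  qed
  moreover have "(\<lambda>n. measure_pmf.prob (pmf_of_set (sc_almost_group_automata n k))
      {\<delta>. synchronizing {..<n} {..<k} \<delta>}) \<longlonglongrightarrow> 1"
  proof -
    have "(\<lambda>n. ?P n * real n ^ (2 * (k - 1)) * (1 / real n ^ (2 * (k - 1)))) \<longlonglongrightarrow> L * 0"
    proof (intro tendsto_mult lim)
      show "(\<lambda>n. 1 / real n ^ (2 * (k - 1))) \<longlonglongrightarrow> 0"
        using assms by real_asymp
    qed
    moreover have "\<forall>\<^sub>F n in sequentially. ?P n * real n ^ (2 * (k - 1)) * (1 / real n ^ (2 * (k - 1))) = ?P n"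
      using eventually_gt_at_top[of 0] by eventually_elim simp
    ultimately have "?P \<longlonglongrightarrow> 0" using Lim_transform_eventually by fastforce
    then have "(\<lambda>n. 1 - ?P n) \<longlonglongrightarrow> 1 - 0" by (intro tendsto_intros)
    moreover have "measure_pmf.prob (pmf_of_set (sc_almost_group_automata n k)) {\<delta>. synchronizing {..<n} {..<k} \<delta>} = 1 - ?P n" for n
      using measure_pmf.prob_compl[of "{\<delta>. \<not> synchronizing {..<n} {..<k} \<delta>}" "pmf_of_set (sc_almost_group_automata n k)"]
      by (simp add: Compl_eq_Diff_UNIV[symmetric] Collect_neg_eq[symmetric])
    ultimately show ?thesis by simp
  qed
  ultimately show ?thesis unfolding L_def by blast
qed

end
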